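(* Let $\beta>1$, $\alpha\in(0,1)$ and $\varrho:=-\frac{\log\alpha}{\log\beta}$. Let $T$ be the excursion length from $0$, with law $\mathbb{P}$, of the biased reflected random walk on $\{0,\ldots,k\}$ with $k$ random and geometrically distributed (as defined in the context). For $t>0$ define $$g(t):=\frac{\beta-1}{\beta}\,\frac{(1-\alpha)\Gamma(\varrho)}{\log\beta}\left(\frac{2\beta}{(\beta-1)^2}\right)^{\varrho}\left[1+\sum_{\ell=1}^\infty c_\ell\cos\left(2\pi\ell\,\frac{\log t}{\log\beta}-d_\ell\right)\right],$$ where $$c_\ell=2\,\frac{\left|\Gamma\left(\varrho+\frac{2\pi i\ell}{\log\beta}\right)\right|}{\Gamma(\varrho)},\qquad d_\ell=\arg\left(\Gamma\left(\varrho+\frac{2\pi i\ell}{\log\beta}\right)\right).$$ Then $$\lim_{t\to\infty}\frac{t^{\varrho}\,\mathbb{P}[T>t]}{g\left(\frac{(\beta-1)^2}{2\beta}\,t\right)}=1.$$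
   Context: For $k\in\mathbb{N}_0=\{0,1,2,\ldots\}$ let $X=(X_n)_{n\ge 0}$ be the discrete-time Markov chain on $\{0,\ldots,k\}$ with $X_0=0$ and the following transitions: from $l\in\{1,\ldots,k-1\}$ it jumps to $l+1$ with probability $\beta/(1+\beta)$ and to $l-1$ with probability $1/(1+\beta)$; if $k\ge1$, from $0$ it jumps to $1$ and from $k$ it jumps to $k-1$ (each with probability one). For $k=0$ the walk is constant equal to $0$. Let $\mathbf{P}_k$ denote probabilities for fixed $k$, and let $\mathbb{P}:=\sum_{k=0}^\infty(1-\alpha)\alpha^k\,\mathbf{P}_k$. If $k\ge1$, $T:=\inf\{t>0: X_t=0\}$; if $k=0$, $T:=0$. $\Gamma$ is Euler's Gamma function, and $\arg(z)\in(-\pi,\pi]$ denotes the argument of a nonzero complex number $z$. *)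

theory Defs
  imports "HOL-Probability.Probability"
begin

text \<open>
  One step of the walk with upper barrier \<open>k\<close>, started in \<open>l\<close>. Only \<open>l \<le> k\<close> matters: the
  set \<open>{0..k}\<close> is closed under these transitions.
\<close>

definition walk_step :: "real \<Rightarrow> nat \<Rightarrow> nat \<Rightarrow> nat pmf" where
  "walk_step \<beta> k l =
     (if k = 0 then return_pmf 0
      else if l = 0 then return_pmf 1
      else if l < k then
        map_pmf (\<lambda>up. if up then l + 1 else l - 1) (bernoulli_pmf (\<beta> / (1 + \<beta>)))
      else return_pmf (k - 1))"

definition markov_chain ::
  "'w measure \<Rightarrow> (nat \<Rightarrow> 'w \<Rightarrow> nat) \<Rightarrow> nat \<Rightarrow> (nat \<Rightarrow> nat pmf) \<Rightarrow> bool" where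
  "markov_chain M X x0 \<kappa> \<longleftrightarrow>
     prob_space M \<and>
     (\<forall>n. X n \<in> measurable M (count_space UNIV)) \<and>
     (AE \<omega> in M. X 0 \<omega> = x0) \<and>
     (\<forall>n x y. \<P>(\<omega> in M. \<forall>i\<le>n. X i \<omega> = x i) > 0 \<longrightarrow>
        \<P>(\<omega> in M. X (Suc n) \<omega> = y \<bar> \<forall>i\<le>n. X i \<omega> = x i) = pmf (\<kappa> (x n)) y)"

text \<open>
  All the laws \<open>P k\<close> live on one measurable space, given by the measure \<open>\<Omega>\<close> (of which only the
  space and the sigma-algebra are used), and all use the same variables \<open>X n\<close>. The random
  variable \<open>K\<close> records the barrier, so that it is available under the mixture of the \<open>P k\<close> too.
\<close>

definition biased_reflected_walk ::
  "real \<Rightarrow> 'w measure \<Rightarrow> (nat \<Rightarrow> 'w measure) \<Rightarrow> ('w \<Rightarrow> nat) \<Rightarrow> (nat \<Rightarrow> 'w \<Rightarrow> nat) \<Rightarrow> bool" where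
  "biased_reflected_walk \<beta> \<Omega> P K X \<longleftrightarrow>
     K \<in> measurable \<Omega> (count_space UNIV) \<and>
     (\<forall>k. sets (P k) = sets \<Omega> \<and> (AE \<omega> in P k. K \<omega> = k) \<and>
          markov_chain (P k) X 0 (walk_step \<beta> k))"

text \<open>
  The measure \<open>\<Sum>k. (1 - \<alpha>) \<alpha>\<^sup>k P k\<close>; see \<open>emeasure_geometric_mixture\<close> below. Note that the
  weights of \<open>geometric_pmf p\<close> are \<open>(1 - p) ^ k * p\<close>.
\<close>

definition geometric_mixture :: "real \<Rightarrow> (nat \<Rightarrow> 'w measure) \<Rightarrow> 'w measure" where
  "geometric_mixture \<alpha> P = measure_pmf (geometric_pmf (1 - \<alpha>)) \<bind> P"

text \<open>
  The value is taken in \<^typ>\<open>enat\<close> so that the infimum of the empty set is \<open>\<infinity>\<close>; on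
  \<^typ>\<open>nat\<close> it would be \<open>0\<close>.
\<close>

definition excursion_length :: "('w \<Rightarrow> nat) \<Rightarrow> (nat \<Rightarrow> 'w \<Rightarrow> nat) \<Rightarrow> 'w \<Rightarrow> enat" where
  "excursion_length K X \<omega> =
     (if K \<omega> = 0 then 0 else (INF t\<in>{t. t > 0 \<and> X t \<omega> = 0}. enat t))"

definition varrho :: "real \<Rightarrow> real \<Rightarrow> real" where
  "varrho \<alpha> \<beta> = - (ln \<alpha> / ln \<beta>)"

definition gamma_coeff :: "real \<Rightarrow> real \<Rightarrow> nat \<Rightarrow> complex" where
  "gamma_coeff \<alpha> \<beta> l =
     Gamma (complex_of_real (varrho \<alpha> \<beta>) + 2 * complex_of_real pi * \<i> * of_nat l / complex_of_real (ln \<beta>))"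

definition c_coeff :: "real \<Rightarrow> real \<Rightarrow> nat \<Rightarrow> real" where
  "c_coeff \<alpha> \<beta> l = 2 * (cmod (gamma_coeff \<alpha> \<beta> l) / Gamma (varrho \<alpha> \<beta>))"

definition d_coeff :: "real \<Rightarrow> real \<Rightarrow> nat \<Rightarrow> real" where
  "d_coeff \<alpha> \<beta> l = Arg (gamma_coeff \<alpha> \<beta> l)"

definition g_fun :: "real \<Rightarrow> real \<Rightarrow> real \<Rightarrow> real" where
  "g_fun \<alpha> \<beta> t =
     (\<beta> - 1) / \<beta> * ((1 - \<alpha>) * Gamma (varrho \<alpha> \<beta>) / ln \<beta>)
       * (2 * \<beta> / (\<beta> - 1)\<^sup>2) powr varrho \<alpha> \<beta>
       * (1 + (\<Sum>j. let l = Suc j in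
              c_coeff \<alpha> \<beta> l * cos (2 * pi * real l * (ln t / ln \<beta>) - d_coeff \<alpha> \<beta> l)))"


subsection \<open>The mixture as a weighted sum\<close>

lemma emeasure_geometric_mixture:
  assumes walk: "biased_reflected_walk \<beta> \<Omega> P K X" and \<alpha>: "0 < \<alpha>" "\<alpha> < 1"
    and A: "A \<in> sets \<Omega>"
  shows "emeasure (geometric_mixture \<alpha> P) A = (\<Sum>k. ennreal ((1 - \<alpha>) * \<alpha> ^ k) * emeasure (P k) A)"
proof -
  have k: "P k \<in> space (subprob_algebra \<Omega>)" for k
    using walk by (auto simp: biased_reflected_walk_def markov_chain_def space_subprob_algebra
        intro: prob_space_imp_subprob_space)
  have "emeasure (geometric_mixture \<alpha> P) A
      = (\<integral>\<^sup>+k. emeasure (P k) A \<partial>measure_pmf (geometric_pmf (1 - \<alpha>)))"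
    unfolding geometric_mixture_def
    by (rule emeasure_bind[where N = \<Omega>]) (use k A in \<open>auto simp: measurable_def\<close>)
  also have "\<dots> = (\<integral>\<^sup>+k. ennreal ((1 - \<alpha>) * \<alpha> ^ k) * emeasure (P k) A \<partial>count_space UNIV)"
    using \<alpha> by (subst nn_integral_measure_pmf) (simp add: mult.commute)
  also have "\<dots> = (\<Sum>k. ennreal ((1 - \<alpha>) * \<alpha> ^ k) * emeasure (P k) A)"
    by (rule nn_integral_count_space_nat)
  finally show ?thesis .
qed


subsection \<open>Existence of the walk\<close>

text \<open>The walk driven by independent coin flips, started in \<open>l\<close>.\<close>

definition move :: "nat \<Rightarrow> nat \<Rightarrow> bool \<Rightarrow> nat" where
  "move k l up =
     (if k = 0 then 0 else if l = 0 then 1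
      else if l < k then (if up then l + 1 else l - 1) else k - 1)"

primrec coin_walk :: "nat \<Rightarrow> nat \<Rightarrow> nat \<Rightarrow> bool stream \<Rightarrow> nat" where
  "coin_walk k 0 l \<omega> = l"
| "coin_walk k (Suc n) l \<omega> = coin_walk k n (move k l (shd \<omega>)) (stl \<omega>)"

lemma walk_step_eq_move:
  "walk_step \<beta> k l = map_pmf (move k l) (bernoulli_pmf (\<beta> / (1 + \<beta>)))"
  by (auto simp: walk_step_def move_def[abs_def] map_pmf_const)

lemma measurable_coin_walk:
  assumes S: "sets M = sets (stream_space (count_space UNIV))"
  shows "(\<lambda>\<omega>. coin_walk k n l \<omega>) \<in> measurable M (count_space UNIV)"
proof -
  have "(\<lambda>\<omega>. coin_walk k n l \<omega>) \<in> measurable (stream_space (count_space UNIV)) (count_space UNIV)"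
  proof (induction n arbitrary: l)
    case 0
    show ?case by (subst measurable_cong[where g = "\<lambda>_. l"]) auto
  next
    case (Suc n)
    note [measurable] = Suc.IH
    have "(\<lambda>\<omega>. (\<lambda>b \<omega>. coin_walk k n (move k l b) (stl \<omega>)) (shd \<omega>) \<omega>)
        \<in> measurable (stream_space (count_space UNIV)) (count_space UNIV)"
      by (rule measurable_compose_countable[where g = shd]) measurable
    then show ?case by simp
  qed
  then show ?thesis
    using measurable_cong_sets[OF S refl] by blast
qed

lemma emeasure_coin_walk_path:
  fixes \<beta> :: real and k :: nat
  defines "B \<equiv> measure_pmf (bernoulli_pmf (\<beta> / (1 + \<beta>)))"
  shows "emeasure (stream_space B) {\<omega> \<in> space (stream_space B). \<forall>i\<le>n. coin_walk k i l \<omega> = x i}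
       = ennreal (indicator {x 0} l * (\<Prod>i<n. pmf (walk_step \<beta> k (x i)) (x (Suc i))))"
proof -
  interpret B: prob_space B unfolding B_def by (rule measure_pmf.prob_space_axioms)
  interpret S: prob_space "stream_space B" by (rule B.prob_space_stream_space)
  have sets: "sets (stream_space B) = sets (stream_space (count_space UNIV))"
    by (rule sets_stream_space_cong) (simp add: B_def)
  note [measurable] = measurable_coin_walk[OF sets]
  have sp: "space (stream_space B) = UNIV"
    by (simp add: space_stream_space B_def)
  show ?thesis
  proof (induction n arbitrary: l x)
    case 0
    then show ?case
      using S.emeasure_space_1 by (auto simp: sp indicator_def)
  next
    case (Suc n)
    define p where "p = (\<Prod>i<n. pmf (walk_step \<beta> k (x (Suc i))) (x (Suc (Suc i))))"
    have p0: "p \<ge> 0" unfolding p_def by (intro prod_nonneg) simp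
    have split: "(\<forall>i\<le>Suc n. coin_walk k i l (b ## \<omega>) = x i)
        \<longleftrightarrow> l = x 0 \<and> (\<forall>i\<le>n. coin_walk k i (move k l b) \<omega> = x (Suc i))" for b \<omega>
      by (auto simp: all_conj_distrib less_Suc_eq_le[symmetric] All_less_Suc2)
    have "emeasure (stream_space B) {\<omega> \<in> space (stream_space B). \<forall>i\<le>Suc n. coin_walk k i l \<omega> = x i}
      = (\<integral>\<^sup>+b. emeasure (stream_space B) {\<omega> \<in> space (stream_space B).
           b ## \<omega> \<in> {\<omega> \<in> space (stream_space B). \<forall>i\<le>Suc n. coin_walk k i l \<omega> = x i}} \<partial>B)"
      by (rule B.emeasure_stream_space) measurable
    also have "\<dots> = (\<integral>\<^sup>+b. indicator {x 0} l * emeasure (stream_space B)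
        {\<omega> \<in> space (stream_space B). \<forall>i\<le>n. coin_walk k i (move k l b) \<omega> = x (Suc i)} \<partial>B)"
      by (intro nn_integral_cong)
        (simp only: sp split mem_Collect_eq UNIV_I simp_thms, auto simp: indicator_def)
    also have "\<dots> = (\<integral>\<^sup>+b. indicator {x 0} l * ennreal p * indicator (move k l -` {x (Suc 0)}) b \<partial>B)"
      using Suc.IH[of _ "\<lambda>i. x (Suc i)"]
      by (intro nn_integral_cong) (auto simp: p_def indicator_def)
    also have "\<dots> = indicator {x 0} l * ennreal p * emeasure B (move k l -` {x (Suc 0)})"
      by (rule nn_integral_cmult_indicator) (simp add: B_def)
    also have "emeasure B (move k l -` {x (Suc 0)}) = ennreal (pmf (walk_step \<beta> k l) (x (Suc 0)))"
      by (simp add: walk_step_eq_move B_def ennreal_pmf_map)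
    also have "indicator {x 0} l * ennreal p * ennreal (pmf (walk_step \<beta> k l) (x (Suc 0)))
      = ennreal (indicator {x 0} l * (\<Prod>i<Suc n. pmf (walk_step \<beta> k (x i)) (x (Suc i))))"
      unfolding prod.lessThan_Suc_shift p_def[symmetric]
      using p0 by (auto simp: indicator_def ennreal_mult mult.commute)
    finally show ?case .
  qed
qed

lemma markov_chain_coin_walk:
  fixes \<beta> :: real and k :: nat
  defines "B \<equiv> measure_pmf (bernoulli_pmf (\<beta> / (1 + \<beta>)))"
  shows "markov_chain (stream_space B) (\<lambda>n. coin_walk k n 0) 0 (walk_step \<beta> k)"
proof -
  interpret B: prob_space B unfolding B_def by (rule measure_pmf.prob_space_axioms)
  interpret S: prob_space "stream_space B" by (rule B.prob_space_stream_space)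
  have sets: "sets (stream_space B) = sets (stream_space (count_space UNIV))"
    by (rule sets_stream_space_cong) (simp add: B_def)
  note meas = measurable_coin_walk[OF sets]
  define q where "q n x = \<P>(\<omega> in stream_space B. \<forall>i\<le>n. coin_walk k i 0 \<omega> = x i)" for n x
  have q: "q n x = indicator {x 0} 0 * (\<Prod>i<n. pmf (walk_step \<beta> k (x i)) (x (Suc i)))" for n x
    unfolding q_def measure_def B_def emeasure_coin_walk_path
    by (intro enn2real_ennreal mult_nonneg_nonneg prod_nonneg) auto
  have "\<P>(\<omega> in stream_space B. coin_walk k (Suc n) 0 \<omega> = y \<bar> \<forall>i\<le>n. coin_walk k i 0 \<omega> = x i)
      = pmf (walk_step \<beta> k (x n)) y" if pos: "q n x > 0" for n x y
  proof -
    define x' where "x' = x(Suc n := y)"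
    have ext: "coin_walk k (Suc n) 0 \<omega> = y \<and> (\<forall>i\<le>n. coin_walk k i 0 \<omega> = x i)
        \<longleftrightarrow> (\<forall>i\<le>Suc n. coin_walk k i 0 \<omega> = x' i)" for \<omega>
      by (auto simp: x'_def le_Suc_eq simp del: coin_walk.simps)
    have "q (Suc n) x' = q n x * pmf (walk_step \<beta> k (x n)) y"
      by (auto simp: q x'_def intro!: prod.cong)
    then show ?thesis
      using pos unfolding cond_prob_def ext q_def[symmetric] by simp
  qed
  then show ?thesis
    unfolding markov_chain_def q_def[symmetric]
    using S.prob_space_axioms meas by auto
qed

lemma biased_reflected_walk_exists:
  "\<exists>\<Omega> P K X. biased_reflected_walk \<beta> (\<Omega> :: (nat \<times> bool stream) measure) P K X"
proof -
  define B where "B = measure_pmf (bernoulli_pmf (\<beta> / (1 + \<beta>)))"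
  define S where "S = stream_space B"
  define \<Omega> where "\<Omega> = count_space (UNIV :: nat set) \<Otimes>\<^sub>M S"
  define P where "P k = distr S \<Omega> (Pair k)" for k
  define X where "X n = (\<lambda>(k, \<omega>). coin_walk k n 0 \<omega>)" for n
  interpret B: prob_space B unfolding B_def by (rule measure_pmf.prob_space_axioms)
  interpret S: prob_space S unfolding S_def by (rule B.prob_space_stream_space)
  have sets: "sets S = sets (stream_space (count_space UNIV))"
    unfolding S_def by (rule sets_stream_space_cong) (simp add: B_def)
  note cw = measurable_coin_walk[OF sets]
  have pair: "Pair k \<in> measurable S \<Omega>" for k
    unfolding \<Omega>_def by measurable
  have X: "X n \<in> measurable \<Omega> (count_space UNIV)" for n
    unfolding X_def \<Omega>_def
    by (rule measurable_pair_measure_countable1) (auto simp: cw)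
  have K: "fst \<in> measurable \<Omega> (count_space UNIV)"
    unfolding \<Omega>_def by measurable
  have event: "\<P>(\<omega> in P k. Q \<omega>) = \<P>(\<omega> in S. Q (k, \<omega>))"
    if "{\<omega> \<in> space \<Omega>. Q \<omega>} \<in> sets \<Omega>" for k Q
    using that measurable_space[OF pair[of k]]
    by (auto simp: P_def measure_distr[OF pair] intro!: arg_cong[where f = "measure S"])
  have hist: "{\<omega> \<in> space \<Omega>. \<forall>i\<le>n. X i \<omega> = x i} \<in> sets \<Omega>"
    and step: "{\<omega> \<in> space \<Omega>. X (Suc n) \<omega> = y \<and> (\<forall>i\<le>n. X i \<omega> = x i)} \<in> sets \<Omega>" for n x y
    using X by measurable
  have "markov_chain (P k) X 0 (walk_step \<beta> k)" for k
  proof -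
    have "prob_space (P k)"
      unfolding P_def by (rule S.prob_space_distr[OF pair])
    moreover have "AE \<omega> in P k. X 0 \<omega> = 0"
      unfolding P_def by (subst AE_distr_iff[OF pair]) (use X in \<open>auto simp: X_def\<close>)
    moreover have "X n \<in> measurable (P k) (count_space UNIV)" for n
      using X by (simp add: P_def)
    ultimately show ?thesis
      using markov_chain_coin_walk[of \<beta> k, folded B_def, folded S_def]
      unfolding markov_chain_def cond_prob_def event[OF hist] event[OF step]
      by (simp add: X_def)
  qed
  moreover have "AE \<omega> in P k. fst \<omega> = k" for k
  proof -
    have "{\<omega> \<in> space \<Omega>. fst \<omega> = k} \<in> sets \<Omega>"
      using K by measurable
    then show ?thesis
      unfolding P_def by (simp add: AE_distr_iff[OF pair])
  qed
  ultimately have "biased_reflected_walk \<beta> \<Omega> P fst X"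
    using K by (simp add: biased_reflected_walk_def P_def)
  then show ?thesis by blast
qed

end

theory Submission
  imports Defs
begin

text \<open>
  The walk with barrier \<open>k\<close>, just after its first step, either falls back to \<open>0\<close> soon, or, with
  probability close to \<open>1 - 1/\<beta>\<close>, drifts up to the barrier. In the latter case it attempts
  many almost independent descents, each of which succeeds with a probability of order
  \<open>\<beta>\<^sup>-\<^sup>k\<close>, so its return time is nearly exponential, with rate \<open>r k = (\<beta> - 1)\<^sup>2 / (2 \<beta> ^ (k + 1))\<close>.
  Thus \<open>P\<^sub>k[T > t]\<close> is close to \<open>(1 - 1/\<beta>) exp (- r k t)\<close>. Write \<open>s = (\<beta> - 1)\<^sup>2 t / (2 \<beta>)\<close>, so
  that \<open>r k t = s / \<beta> ^ k\<close>. Averaging over \<open>k\<close> gives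

  \<open>P[T > t] \<approx> (1 - \<alpha>) (1 - 1/\<beta>) (\<Sum>k\<ge>0. \<alpha> ^ k exp (- s / \<beta> ^ k))\<close>.

  Since \<open>\<alpha> = \<beta> powr - \<rho>\<close>, multiplication by \<open>s powr \<rho>\<close> turns the sum into
  \<open>\<Sum>k\<ge>0. \<psi> (ln s - k ln \<beta>)\<close> with the Gamma kernel \<open>\<psi> v = exp (\<rho> v - exp v)\<close>. The
  terms with \<open>k < 0\<close> are negligible for large \<open>s\<close>, and the sum over all integers is a periodic function of
  \<open>ln s\<close>. Its Fourier coefficients are values of the Fourier transform of \<open>\<psi>\<close>, which is the Gamma
  function on a vertical line. So its Fourier series is, up to a constant factor, the bracket in the
  definition of \<open>g\<close>: see \<open>g_fun_eq_periodized_kernel\<close>. As the periodic function is bounded away from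
  \<open>0\<close>, it suffices to control additive errors.

  The core is the estimate for fixed \<open>k\<close>, which has to be uniform in \<open>k\<close> and in time
  (\<open>survival_near_exponential\<close>). Let \<open>Q\<close> be the transition operator of the walk killed at \<open>0\<close>. In place
  of its principal eigenvector the proof uses the mean exit time, multiplied by \<open>r k\<close>. This
  function \<open>h\<close> is explicit, satisfies \<open>Q h = h - r k\<close> exactly, and differs from \<open>1\<close> appreciably only
  near \<open>0\<close>. A surviving walk is rarely near \<open>0\<close>, so the means \<open>a n\<close> of \<open>h\<close> over the surviving paths
  and the survival probabilities \<open>p n\<close> are close to each other. Hence \<open>a (n + 1) = a n - r k p n\<close> is almost the
  recursion of an exponential, which starts from \<open>h 1 \<approx> 1 - 1/\<beta>\<close>. The geometric mean of
  this error bound with the crude exponential tail \<open>survival_exponential_bound\<close> decays in \<open>r k t\<close> and,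
  up to a term that is exponentially small in \<open>t\<close>, also in \<open>k\<close>. So it can be summed against the
  weights \<open>\<alpha> ^ k\<close> (\<open>tail_sum_error\<close>).
\<close>

section \<open>Fourier series at an endpoint\<close>

definition wave :: "int \<Rightarrow> real \<Rightarrow> complex" where
  "wave l x = cis (2 * pi * of_int l * x)"

definition fourier_coeff :: "(real \<Rightarrow> complex) \<Rightarrow> int \<Rightarrow> complex" where
  "fourier_coeff F l = integral {0..1} (\<lambda>x. F x * wave (- l) x)"

lemma continuous_on_wave [continuous_intros]: "continuous_on S (wave l)"
  unfolding wave_def by (intro continuous_intros)

lemma norm_wave [simp]: "norm (wave l x) = 1"
  by (simp add: wave_def)

lemma wave_has_vector_derivative:
  "(wave l has_vector_derivative (2 * pi * of_int l) *\<^sub>R (\<i> * wave l x)) (at x within S)"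
  unfolding wave_def has_vector_derivative_def
  by (auto intro!: derivative_eq_intros simp: scaleR_conv_of_real algebra_simps)

lemma wave_at_endpoints [simp]: "wave l 0 = 1" "wave l 1 = 1"
  by (simp_all add: wave_def cis_multiple_2pi)

lemma wave_mult: "wave k x * wave l x = wave (k + l) x"
  by (simp add: wave_def cis_mult algebra_simps)

lemma wave_add_of_nat: "wave l (x + real n) = wave l x" "wave l (x - real n) = wave l x"
proof -
  have 1: "cis (2 * pi * of_int l * real n) = 1"
    using cis_multiple_2pi[of "of_int (l * int n)"] by (simp add: mult_ac)
  have "wave l (x + real n) = wave l x * cis (2 * pi * of_int l * real n)"
    by (simp add: wave_def cis_mult algebra_simps)
  then show "wave l (x + real n) = wave l x" using 1 by simp
  have "wave l (x - real n) = wave l x / cis (2 * pi * of_int l * real n)"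
    by (simp add: wave_def cis_divide algebra_simps)
  then show "wave l (x - real n) = wave l x" using 1 by simp
qed

text \<open>
  Integration by parts moves the derivative onto the polynomial and produces the factor
  \<open>1 / (2 \<pi> l)\<close>. The boundary terms need not cancel, because a polynomial is not periodic, but they
  are bounded.
\<close>

lemma fourier_coeff_polynomial_bound:
  assumes "polynomial_function p"
  obtains C where "\<And>l. l \<noteq> 0 \<Longrightarrow> norm (fourier_coeff p l) \<le> C / \<bar>of_int l\<bar>"
proof -
  obtain p' where p': "polynomial_function p'" "\<And>x. (p has_vector_derivative p' x) (at x)"
    using has_vector_derivative_polynomial_function[OF assms] by blast
  have cp: "continuous_on S p" "continuous_on S p'" for S
    using assms p' by (auto intro!: continuous_on_polymonial_function)
  obtain B where B: "\<And>x. x \<in> {0..1} \<Longrightarrow> norm (p' x) \<le> B"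
    using compact_imp_bounded[OF compact_continuous_image[OF cp(2) compact_Icc[of 0 "1::real"]]]
    unfolding bounded_iff by (metis imageI)
  define C where "C = norm (p 0) + norm (p 1) + B"
  have "norm (fourier_coeff p l) \<le> C / \<bar>of_int l\<bar>" if l: "l \<noteq> 0" for l
  proof -
    define w where "w = 2 * pi * real_of_int (- l)"
    have D: "((\<lambda>x. p x * wave (-l) x) has_vector_derivative
        p x * (w *\<^sub>R (\<i> * wave (-l) x)) + p' x * wave (-l) x) (at x within {0..1})" for x
      unfolding w_def
      by (rule has_vector_derivative_mult[OF has_vector_derivative_at_within[OF p'(2)] wave_has_vector_derivative])
    have "((\<lambda>x. p x * (w *\<^sub>R (\<i> * wave (-l) x)) + p' x * wave (-l) x) has_integral
        p 1 * wave (-l) 1 - p 0 * wave (-l) 0) {0..1}"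
      by (rule fundamental_theorem_of_calculus) (use D in auto)
    moreover have "((\<lambda>x. p' x * wave (-l) x) has_integral integral {0..1} (\<lambda>x. p' x * wave (-l) x)) {0..1}"
      by (intro integrable_integral integrable_continuous_real continuous_intros cp)
    ultimately have "((\<lambda>x. p x * (w *\<^sub>R (\<i> * wave (-l) x))) has_integral
        (p 1 - p 0 - integral {0..1} (\<lambda>x. p' x * wave (-l) x))) {0..1}"
      by (drule_tac has_integral_diff) (assumption, simp)
    moreover have "((\<lambda>x. (\<i> * w) * (p x * wave (-l) x)) has_integral (\<i> * w) * fourier_coeff p l) {0..1}"
      unfolding fourier_coeff_def
      by (intro has_integral_mult_right integrable_integral integrable_continuous_real continuous_intros cp)
    ultimately have eq: "(\<i> * w) * fourier_coeff p l = p 1 - p 0 - integral {0..1} (\<lambda>x. p' x * wave (-l) x)"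
      by (intro has_integral_unique[of _ _ "{0..1}"]) (auto simp: scaleR_conv_of_real algebra_simps)
    have "norm (integral {0..1} (\<lambda>x. p' x * wave (-l) x)) \<le> B * (1 - 0)"
      by (rule integral_bound) (auto intro!: continuous_intros cp simp: norm_mult B)
    then have "norm ((\<i> * w) * fourier_coeff p l) \<le> C"
      unfolding eq C_def
      using norm_triangle_ineq4[of "p 1 - p 0" "integral {0..1} (\<lambda>x. p' x * wave (-l) x)"]
        norm_triangle_ineq4[of "p 1" "p 0"] by simp
    then have "\<bar>w\<bar> * norm (fourier_coeff p l) \<le> C" by (simp add: norm_mult)
    moreover have "\<bar>real_of_int l\<bar> * 1 \<le> \<bar>w\<bar>"
      using mult_right_mono[of 1 "2 * pi" "\<bar>real_of_int l\<bar>"] pi_gt3 by (simp add: w_def abs_mult)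
    ultimately have "\<bar>real_of_int l\<bar> * norm (fourier_coeff p l) \<le> C"
      using mult_right_mono[of "\<bar>real_of_int l\<bar>" "\<bar>w\<bar>" "norm (fourier_coeff p l)"] by simp
    then show ?thesis using l by (simp add: field_simps)
  qed
  then show thesis by (rule that)
qed

text \<open>
  A uniform approximation by a polynomial changes all Fourier coefficients by at most the error of the
  approximation, and those of the polynomial tend to \<open>0\<close>.
\<close>

lemma Riemann_Lebesgue_continuous:
  assumes G: "continuous_on {0..1} G" and e: "e > 0"
  obtains N where "\<And>l. \<bar>l\<bar> \<ge> N \<Longrightarrow> norm (fourier_coeff G l) < e"
proof -
  obtain p where p: "polynomial_function p" "\<And>x. x \<in> {0..1} \<Longrightarrow> norm (G x - p x) < e/2"
    using Stone_Weierstrass_polynomial_function[OF compact_Icc G, of "e/2"] e by auto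
  have cp: "continuous_on {0..1} p"
    using p by (intro continuous_on_polymonial_function)
  obtain C where C: "\<And>l. l \<noteq> 0 \<Longrightarrow> norm (fourier_coeff p l) \<le> C / \<bar>of_int l\<bar>"
    using fourier_coeff_polynomial_bound[OF p(1)] by blast
  define N where "N = max 1 (\<lfloor>2 * C / e\<rfloor> + 1)"
  have "norm (fourier_coeff G l) < e" if "\<bar>l\<bar> \<ge> N" for l
  proof -
    have l: "l \<noteq> 0" "\<bar>real_of_int l\<bar> > 2 * C / e" using that unfolding N_def by linarith+
    have "fourier_coeff G l - fourier_coeff p l = integral {0..1} (\<lambda>x. (G x - p x) * wave (-l) x)"
      unfolding fourier_coeff_def left_diff_distrib
      by (rule integral_diff[symmetric]; intro integrable_continuous_real continuous_intros G cp)
    also have "norm \<dots> \<le> e / 2 * (1 - 0)"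
      by (rule integral_bound) (use p(2) in \<open>auto intro!: continuous_intros G cp simp: norm_mult less_imp_le\<close>)
    finally have "norm (fourier_coeff G l) \<le> norm (fourier_coeff p l) + e/2"
      using norm_triangle_sub[of "fourier_coeff G l" "fourier_coeff p l"] by simp
    moreover have "norm (fourier_coeff p l) < e/2"
    proof -
      have "norm (fourier_coeff p l) \<le> C / \<bar>of_int l\<bar>" by (rule C) fact
      also have "\<dots> < e / 2" using l e by (auto simp: field_simps)
      finally show ?thesis .
    qed
    ultimately show ?thesis by linarith
  qed
  then show thesis by (rule that)
qed

lemma has_vector_derivative_imp_quotient_tendsto:
  fixes f :: "real \<Rightarrow> 'a::real_normed_vector"
  assumes "(f has_vector_derivative D) (at a within S)"
  shows "((\<lambda>x. (f x - f a) /\<^sub>R (x - a)) \<longlongrightarrow> D) (at a within S)"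
proof -
  have "((\<lambda>y. norm (f y - f a - (y - a) *\<^sub>R D) / norm (y - a)) \<longlongrightarrow> 0) (at a within S)"
    using assms unfolding has_vector_derivative_def has_derivative_iff_norm by blast
  then have "((\<lambda>y. norm ((f y - f a) /\<^sub>R (y - a) - D)) \<longlongrightarrow> 0) (at a within S)"
  proof (rule Lim_transform_eventually)
    show "\<forall>\<^sub>F y in at a within S. norm (f y - f a - (y - a) *\<^sub>R D) / norm (y - a)
        = norm ((f y - f a) /\<^sub>R (y - a) - D)"
      unfolding eventually_at
    proof (intro exI[of _ 1] conjI ballI impI)
      fix y assume "y \<noteq> a \<and> dist y a < 1"
      then have "(f y - f a) /\<^sub>R (y - a) - D = (f y - f a - (y - a) *\<^sub>R D) /\<^sub>R (y - a)"
        by (simp add: scaleR_diff_right)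
      then show "norm (f y - f a - (y - a) *\<^sub>R D) / norm (y - a) = norm ((f y - f a) /\<^sub>R (y - a) - D)"
        by (simp add: divide_inverse mult.commute)
    qed simp
  qed
  then show ?thesis
    using tendsto_norm_zero_iff LIM_zero_iff by blast
qed

text \<open>
  Continuity at the endpoints of the quotient that \<open>fourier_series_converges_at_endpoint\<close> works with.
\<close>

lemma difference_over_wave_tendsto:
  fixes F :: "real \<Rightarrow> complex"
  assumes "(F has_vector_derivative D) (at a within S)" "wave 1 a = 1"
  shows "((\<lambda>x. (F x - F a) / (wave 1 x - 1)) \<longlongrightarrow> D / (2 * pi * \<i>)) (at a within S)"
proof -
  note 1 = has_vector_derivative_imp_quotient_tendsto[OF assms(1)]
  have 2: "((\<lambda>x. (wave 1 x - 1) /\<^sub>R (x - a)) \<longlongrightarrow> 2 * pi * \<i>) (at a within S)"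
    using has_vector_derivative_imp_quotient_tendsto[OF wave_has_vector_derivative[of 1 a S]] assms(2)
    by (simp add: scaleR_conv_of_real)
  have "((\<lambda>x. ((F x - F a) /\<^sub>R (x - a)) / ((wave 1 x - 1) /\<^sub>R (x - a))) \<longlongrightarrow> D / (2 * pi * \<i>)) (at a within S)"
    by (rule tendsto_divide[OF 1 2]) simp
  then show ?thesis
  proof (rule Lim_transform_eventually)
    show "\<forall>\<^sub>F x in at a within S. ((F x - F a) /\<^sub>R (x - a)) / ((wave 1 x - 1) /\<^sub>R (x - a))
        = (F x - F a) / (wave 1 x - 1)"
      unfolding eventually_at
      by (intro exI[of _ 1]) (auto simp: scaleR_conv_of_real divide_simps)
  qed
qed

text \<open>
  Chernoff's argument. The quotient \<open>G = (F - F 0) / (wave 1 - 1)\<close> extends continuously to the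
  endpoints, because \<open>F\<close> is differentiable there. Multiplication by \<open>wave 1\<close> shifts
  Fourier coefficients, so those of \<open>F - F 0\<close> are differences of consecutive coefficients of
  \<open>G\<close>. The symmetric partial sums telescope, and what is left tends to \<open>0\<close> by Riemann and Lebesgue.
\<close>

lemma fourier_series_converges_at_endpoint:
  fixes F :: "real \<Rightarrow> complex"
  assumes F: "continuous_on {0..1} F" and per: "F 1 = F 0"
    and d0: "(F has_vector_derivative D0) (at 0 within {0..1})"
    and d1: "(F has_vector_derivative D1) (at 1 within {0..1})"
  shows "(\<lambda>n. fourier_coeff F (int (Suc n)) + fourier_coeff F (- int (Suc n))) sums (F 0 - fourier_coeff F 0)"
proof -
  define G where "G x = (if x = 0 then D0 / (2 * pi * \<i>) else if x = 1 then D1 / (2 * pi * \<i>)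
      else (F x - F 0) / (wave 1 x - 1))" for x
  have w1: "wave 1 x \<noteq> 1" if "x \<in> {0<..<1}" for x
  proof
    assume "wave 1 x = 1"
    then have "cos (2 * pi * x) = 1" by (simp add: wave_def cis.ctr complex_eq_iff)
    then obtain n where "2 * pi * x = of_int n * 2 * pi" using cos_one_2pi_int by auto
    then have "x = of_int n" by simp
    with that show False by auto
  qed
  have G: "continuous_on {0..1} G"
    unfolding continuous_on_eq_continuous_within
  proof
    fix a :: real assume "a \<in> {0..1}"
    then consider "a = 0" | "a = 1" | "a \<in> {0<..<1}" by fastforce
    then show "continuous (at a within {0..1}) G"
    proof cases
      case 1
      have "(G \<longlongrightarrow> D0 / (2 * pi * \<i>)) (at 0 within {0..1})"
        by (rule Lim_transform_eventually[OF difference_over_wave_tendsto[OF d0]])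
          (auto simp: G_def eventually_at intro!: exI[of _ 1])
      then show ?thesis using 1 by (simp add: continuous_within G_def)
    next
      case 2
      have "(G \<longlongrightarrow> D1 / (2 * pi * \<i>)) (at 1 within {0..1})"
        by (rule Lim_transform_eventually[OF difference_over_wave_tendsto[OF d1]])
          (auto simp: G_def eventually_at dist_real_def per intro!: exI[of _ 1])
      then show ?thesis using 2 by (simp add: continuous_within G_def)
    next
      case 3
      have "continuous_on {0<..<1} (\<lambda>x. (F x - F 0) / (wave 1 x - 1))"
        using w1 by (intro continuous_intros continuous_on_subset[OF F]) auto
      then have "continuous_on {0<..<1} G"
        by (rule continuous_on_eq) (auto simp: G_def)
      then have "isCont G a" using 3 by (simp add: continuous_on_eq_continuous_at)
      then show ?thesis by (rule continuous_at_imp_continuous_within)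
    qed
  qed
  have FG: "F x - F 0 = G x * (wave 1 x - 1)" if "x \<in> {0..1}" for x
    using that w1[of x] per by (auto simp: G_def)
  have tele: "fourier_coeff F l - (if l = 0 then F 0 else 0) = fourier_coeff G (l - 1) - fourier_coeff G l" for l
  proof -
    have c: "integral {0..1} (\<lambda>x. F 0 * wave (- l) x) = (if l = 0 then F 0 else 0)"
    proof (cases "l = 0")
      case False
      have "((\<lambda>x. (2 * pi * of_int (- l)) *\<^sub>R (\<i> * wave (- l) x)) has_integral wave (- l) 1 - wave (- l) 0) {0..1}"
        by (rule fundamental_theorem_of_calculus) (rule zero_le_one wave_has_vector_derivative)+
      then have "((\<lambda>x. F 0 / (2 * pi * of_int (- l) * \<i>) * ((2 * pi * of_int (- l)) *\<^sub>R (\<i> * wave (- l) x)))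
          has_integral F 0 / (2 * pi * of_int (- l) * \<i>) * 0) {0..1}"
        by (intro has_integral_mult_right) simp
      also have "(\<lambda>x. F 0 / (2 * pi * of_int (- l) * \<i>) * ((2 * pi * of_int (- l)) *\<^sub>R (\<i> * wave (- l) x)))
          = (\<lambda>x. F 0 * wave (- l) x)"
        using False by (simp add: scaleR_conv_of_real field_simps)
      finally have "integral {0..1} (\<lambda>x. F 0 * wave (- l) x) = 0"
        by (intro integral_unique) simp
      with False show ?thesis by simp
    qed (simp add: wave_def)
    have "fourier_coeff F l - integral {0..1} (\<lambda>x. F 0 * wave (- l) x)
       = integral {0..1} (\<lambda>x. F x * wave (-l) x - F 0 * wave (-l) x)"
      unfolding fourier_coeff_def
      by (rule integral_diff[symmetric]; intro integrable_continuous_real continuous_intros F)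
    also have "\<dots> = integral {0..1} (\<lambda>x. G x * wave (-(l-1)) x - G x * wave (-l) x)"
    proof (rule integral_cong)
      fix x :: real assume "x \<in> {0..1}"
      have "F x * wave (-l) x - F 0 * wave (-l) x = (F x - F 0) * wave (-l) x" by (simp add: algebra_simps)
      also have "\<dots> = G x * (wave 1 x * wave (-l) x) - G x * wave (-l) x"
        unfolding FG[OF \<open>x \<in> _\<close>] by (simp only: left_diff_distrib right_diff_distrib mult_1_right mult.assoc mult_1_left)
      finally show "F x * wave (-l) x - F 0 * wave (-l) x = G x * wave (-(l-1)) x - G x * wave (-l) x"
        by (simp add: wave_mult)
    qed
    also have "\<dots> = fourier_coeff G (l - 1) - fourier_coeff G l"
      unfolding fourier_coeff_def
      by (rule integral_diff; intro integrable_continuous_real continuous_intros G)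
    finally show ?thesis unfolding c .
  qed
  have partial: "(\<Sum>n<N. fourier_coeff F (int (Suc n)) + fourier_coeff F (- int (Suc n)))
     = F 0 - fourier_coeff F 0 + (fourier_coeff G (- int (Suc N)) - fourier_coeff G (int N))" for N
  proof (induction N)
    case 0 then show ?case using tele[of 0] by (simp add: algebra_simps)
  next
    case (Suc N)
    have pos: "fourier_coeff F (int (Suc N)) = fourier_coeff G (int N) - fourier_coeff G (int (Suc N))"
      using tele[of "int (Suc N)"] by simp
    have neg: "fourier_coeff F (- int (Suc N)) = fourier_coeff G (- int (Suc (Suc N))) - fourier_coeff G (- int (Suc N))"
      using tele[of "- int (Suc N)"] by (simp add: algebra_simps)
    show ?case unfolding sum.lessThan_Suc Suc.IH pos neg by simp
  qed
  have lim: "(\<lambda>N. fourier_coeff G (- int (Suc N))) \<longlonglongrightarrow> 0" "(\<lambda>N. fourier_coeff G (int N)) \<longlonglongrightarrow> 0"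
  proof -
    have small: "\<exists>N0. \<forall>l. \<bar>l\<bar> \<ge> N0 \<longrightarrow> norm (fourier_coeff G l) < e" if "e > 0" for e
      using Riemann_Lebesgue_continuous[OF G that] by metis
    show "(\<lambda>N. fourier_coeff G (- int (Suc N))) \<longlonglongrightarrow> 0"
    proof (rule LIMSEQ_I)
      fix e :: real assume "e > 0"
      from small[OF this] obtain N0 where "\<And>l. \<bar>l\<bar> \<ge> N0 \<Longrightarrow> norm (fourier_coeff G l) < e" by blast
      then show "\<exists>no. \<forall>n\<ge>no. norm (fourier_coeff G (- int (Suc n)) - 0) < e"
        by (intro exI[of _ "nat N0"]) simp
    qed
    show "(\<lambda>N. fourier_coeff G (int N)) \<longlonglongrightarrow> 0"
    proof (rule LIMSEQ_I)
      fix e :: real assume "e > 0"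
      from small[OF this] obtain N0 where "\<And>l. \<bar>l\<bar> \<ge> N0 \<Longrightarrow> norm (fourier_coeff G l) < e" by blast
      then show "\<exists>no. \<forall>n\<ge>no. norm (fourier_coeff G (int n) - 0) < e"
        by (intro exI[of _ "nat N0"]) simp
    qed
  qed
  show ?thesis unfolding sums_def partial
    using tendsto_add[OF tendsto_const tendsto_diff[OF lim], of "F 0 - fourier_coeff F 0"] by simp
qed

section \<open>Periodizing the Gamma kernel\<close>

text \<open>
  The integrand of the Gamma function in logarithmic coordinates: the substitution \<open>x = exp v\<close> turns
  \<open>x powr (\<rho> - 1) * exp (- x) dx\<close> into \<open>gamma_kernel \<rho> v dv\<close>.
\<close>

definition gamma_kernel :: "real \<Rightarrow> real \<Rightarrow> real" where
  "gamma_kernel \<rho> v = exp (\<rho> * v - exp v)"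

text \<open>
  To the left the factor \<open>exp (\<rho> v)\<close> decays; to the right \<open>exp v \<ge> v\<^sup>2 / 2\<close> beats every linear function,
  and completing the square gives the constant. The case \<open>\<delta> = 0\<close> is the bound behind
  \<open>exp_minus_le_powr\<close>.
\<close>

lemma gamma_kernel_decay:
  assumes "0 \<le> \<delta>" "\<delta> \<le> \<rho>"
  shows "gamma_kernel \<rho> v \<le> exp ((\<rho> + \<delta>)\<^sup>2 / 2) * exp (- (\<delta> * \<bar>v\<bar>))"
proof -
  have "\<rho> * v - exp v \<le> (\<rho> + \<delta>)\<^sup>2 / 2 - \<delta> * \<bar>v\<bar>"
  proof (cases "v \<ge> 0")
    case True
    have "1 + v + v\<^sup>2 / 2 \<le> exp v" by (rule exp_lower_Taylor_quadratic) fact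
    moreover have "0 \<le> (v - (\<rho> + \<delta>))\<^sup>2" by simp
    ultimately show ?thesis using True by (simp add: power2_eq_square algebra_simps)
  next
    case False
    then have "\<rho> * v \<le> \<delta> * v" using assms by (intro mult_right_mono_neg) auto
    moreover have "0 \<le> (\<rho> + \<delta>)\<^sup>2 / 2" by simp
    moreover have "0 < exp v" by simp
    ultimately have "\<rho> * v - exp v \<le> (\<rho> + \<delta>)\<^sup>2 / 2 + \<delta> * v" by linarith
    then show ?thesis using False by simp
  qed
  then show ?thesis unfolding gamma_kernel_def exp_add[symmetric] by simp
qed

lemma gamma_kernel_pos: "gamma_kernel \<sigma> v > 0"
  by (simp add: gamma_kernel_def)

lemma gamma_kernel_has_derivative:
  "(gamma_kernel \<rho> has_field_derivative \<rho> * gamma_kernel \<rho> v - gamma_kernel (\<rho> + 1) v) (at v within S)"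
proof -
  have "((\<lambda>v. exp (\<rho> * v - exp v)) has_field_derivative exp (\<rho> * v - exp v) * (\<rho> - exp v)) (at v within S)"
    by (auto intro!: derivative_eq_intros)
  moreover have "exp (\<rho> * v - exp v) * (\<rho> - exp v) = \<rho> * exp (\<rho> * v - exp v) - exp ((\<rho> + 1) * v - exp v)"
    by (simp add: exp_add exp_diff field_simps)
  ultimately show ?thesis
    unfolding gamma_kernel_def by (simp only:)
qed

lemma continuous_on_gamma_kernel [continuous_intros]:
  "continuous_on S f \<Longrightarrow> continuous_on S (\<lambda>x. gamma_kernel \<rho> (f x))"
  unfolding gamma_kernel_def by (intro continuous_intros)

lemma exp_minus_le_powr:
  fixes a x \<tau> :: real
  assumes "a > 0" "x > 0" "\<tau> \<ge> 0"
  shows "exp (- (a * x)) \<le> exp (\<tau>\<^sup>2 / 2) * a powr - \<tau> * x powr - \<tau>"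
proof -
  have "gamma_kernel \<tau> (ln (a * x)) \<le> exp ((\<tau> + 0)\<^sup>2 / 2) * exp (- (0 * \<bar>ln (a * x)\<bar>))"
    by (rule gamma_kernel_decay) (use assms in auto)
  moreover have "gamma_kernel \<tau> (ln (a * x)) = (a * x) powr \<tau> * exp (- (a * x))"
    using assms by (simp add: gamma_kernel_def powr_def exp_diff exp_minus divide_inverse)
  ultimately have "(a * x) powr \<tau> * exp (- (a * x)) \<le> exp (\<tau>\<^sup>2 / 2)" by simp
  then have "exp (- (a * x)) \<le> exp (\<tau>\<^sup>2 / 2) * (a * x) powr - \<tau>"
    using assms by (simp add: powr_minus field_simps)
  then show ?thesis using assms by (simp add: powr_mult mult.assoc)
qed

text \<open>
  The sum over all integer shifts is arranged as a series over \<open>n\<close> that pairs the shifts \<open>n\<close> and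
  \<open>- n - 1\<close>. Then \<open>N\<close> terms integrate over \<open>[0, 1]\<close> to an integral over \<open>[- N, N]\<close>.
\<close>

definition shift_pair :: "real \<Rightarrow> real \<Rightarrow> real \<Rightarrow> nat \<Rightarrow> real \<Rightarrow> real" where
  "shift_pair \<rho> L u n x = gamma_kernel \<rho> (u + L * (x + real n)) + gamma_kernel \<rho> (u + L * (x - real (Suc n)))"

definition periodized_kernel :: "real \<Rightarrow> real \<Rightarrow> real \<Rightarrow> real \<Rightarrow> real" where
  "periodized_kernel \<rho> L u x = (\<Sum>n. shift_pair \<rho> L u n x)"

text \<open>
  The waves have period \<open>1\<close>, so each shift of the kernel contributes the integral over a
  translate of the unit interval, and these intervals fit together.
\<close>

lemma integral_partial_periodization:
  "integral {0..1} (\<lambda>x. of_real (\<Sum>n<N. shift_pair \<rho> L u n x) * wave l x)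
     = integral {- real N..real N} (\<lambda>x. of_real (gamma_kernel \<rho> (u + L * x)) * wave l x)"
proof -
  define f where "f x = complex_of_real (gamma_kernel \<rho> (u + L * x)) * wave l x" for x
  have cf: "continuous_on S f" for S unfolding f_def by (intro continuous_intros)
  have int: "f integrable_on {a..b}" for a b by (rule integrable_continuous_real[OF cf])
  have right: "integral {0..1} (\<lambda>x. f (x + c)) = integral {c..1 + c} f" for c
    using integral_shift[OF cf, of 0 1 c] by (simp add: o_def)
  show ?thesis unfolding f_def[symmetric]
  proof (induction N)
    case (Suc N)
    \<comment> \<open>The two shifts extend the interval of integration by one unit on either side.\<close>
    have pair: "complex_of_real (shift_pair \<rho> L u N x) * wave l x = f (x + real N) + f (x + - real (Suc N))" for x
      using wave_add_of_nat[of l x N] wave_add_of_nat[of l x "Suc N"]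
      by (simp add: shift_pair_def f_def algebra_simps)
    have "integral {0..1} (\<lambda>x. of_real (\<Sum>n<Suc N. shift_pair \<rho> L u n x) * wave l x)
       = integral {0..1} (\<lambda>x. of_real (\<Sum>n<N. shift_pair \<rho> L u n x) * wave l x + (f (x + real N) + f (x + - real (Suc N))))"
      unfolding pair[symmetric] by (simp add: algebra_simps)
    also have "\<dots> = integral {- real N..real N} f + (integral {real N..1 + real N} f + integral {- real (Suc N)..1 + - real (Suc N)} f)"
    proof -
      have c: "continuous_on {0..1} (\<lambda>x. f (x + c))" for c
        by (intro continuous_on_compose2[OF cf[of UNIV]] continuous_intros) auto
      have c2: "continuous_on {0..1} (\<lambda>x. of_real (\<Sum>n<N. shift_pair \<rho> L u n x) * wave l x)"
        unfolding shift_pair_def by (intro continuous_intros)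
      show ?thesis
        unfolding right[symmetric] Suc.IH[symmetric]
        by (subst integral_add; (intro integrable_add integrable_continuous_real c c2)?)
           (subst integral_add; (intro integrable_continuous_real c)?; simp)
    qed
    also have "\<dots> = integral {- real (Suc N)..real (Suc N)} f"
    proof -
      have 1: "integral {- real (Suc N)..- real N} f + integral {- real N..real N} f = integral {- real (Suc N)..real N} f"
        by (rule Henstock_Kurzweil_Integration.integral_combine) (auto intro: int)
      have 2: "integral {- real (Suc N)..real N} f + integral {real N..real (Suc N)} f = integral {- real (Suc N)..real (Suc N)} f"
        by (rule Henstock_Kurzweil_Integration.integral_combine) (auto intro: int)
      have succ: "1 + real N = real (Suc N)" "- real (Suc N) + 1 = - real N" "1 + - real (Suc N) = - real N" by simp_all
      show ?thesis unfolding succ 2[symmetric] 1[symmetric] by (simp only: add_ac)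
    qed
    finally show ?case .
  qed simp
qed

lemma truncated_Gamma_integral_tendsto:
  assumes z: "Re z > 0" and a: "a \<longlonglongrightarrow> 0" "\<And>n. a n > (0::real)" and B: "filterlim b at_top sequentially"
  shows "(\<lambda>n. integral {a n..b n} (\<lambda>t. of_real t powr (z - 1) / of_real (exp t))) \<longlonglongrightarrow> Gamma z"
proof -
  define f where "f t = complex_of_real t powr (z - 1) / of_real (exp t)" for t
  define fn where "fn n t = (if t \<in> {a n..b n} then f t else 0)" for n t
  have sub: "{a n..b n} \<subseteq> {0<..}" for n using a(2)[of n] by auto
  have cont: "continuous_on {a n..b n} f" for n
    unfolding f_def using a(2)[of n] by (intro continuous_intros) (auto simp: complex_nonpos_Reals_iff)
  have "f absolutely_integrable_on {0<..}"
    unfolding f_def by (rule absolutely_integrable_Gamma_integral'[OF z])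
  then have norm: "(\<lambda>t. norm (f t)) integrable_on {0<..}"
    by (simp add: absolutely_integrable_on_def)
  have "(\<lambda>n. integral {0<..} (fn n)) \<longlonglongrightarrow> integral {0<..} f"
  proof (rule dominated_convergence[OF _ norm])
    fix n
    have "f integrable_on {a n..b n}" by (rule integrable_continuous_real[OF cont])
    then show "fn n integrable_on {0<..}"
      unfolding fn_def integrable_on_def using has_integral_restrict[OF sub, where f = f] by blast
  next
    fix n t show "norm (fn n t) \<le> norm (f t)" by (simp add: fn_def)
  next
    fix t :: real assume t: "t \<in> {0<..}"
    have "\<forall>\<^sub>F n in sequentially. a n < t" using order_tendstoD(2)[OF a(1)] t by simp
    moreover have "\<forall>\<^sub>F n in sequentially. t \<le> b n" using B by (simp add: filterlim_at_top)
    ultimately have "\<forall>\<^sub>F n in sequentially. fn n t = f t"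
      by eventually_elim (simp add: fn_def)
    then show "(\<lambda>n. fn n t) \<longlonglongrightarrow> f t" by (rule tendsto_eventually)
  qed
  moreover have "integral {0<..} (fn n) = integral {a n..b n} f" for n
    using integral_restrict_Int[of "{0<..}" "{a n..b n}" f] sub[of n] by (simp add: fn_def[abs_def] Int_absorb2)
  moreover have "integral {0<..} f = Gamma z"
    unfolding f_def by (intro integral_unique Gamma_integral_complex'[OF z])
  ultimately show ?thesis by (simp add: f_def[abs_def])
qed

context
  fixes \<rho> L u :: real
  assumes \<rho>: "\<rho> > 0" and L: "L > 0"
begin

lemma kernel_bound_at_shift:
  assumes "x \<in> {0..1}" "\<rho> \<le> \<sigma>"
  shows "gamma_kernel \<sigma> (u + L * (x + real n)) \<le> exp ((\<sigma> + \<rho>)\<^sup>2 / 2) * exp (\<rho> * \<bar>u\<bar>) * exp (- \<rho> * L) ^ n"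
    "gamma_kernel \<sigma> (u + L * (x - real (Suc n))) \<le> exp ((\<sigma> + \<rho>)\<^sup>2 / 2) * exp (\<rho> * \<bar>u\<bar>) * exp (- \<rho> * L) ^ n"
proof -
  have *: "gamma_kernel \<sigma> v \<le> exp ((\<sigma> + \<rho>)\<^sup>2 / 2) * exp (\<rho> * \<bar>u\<bar>) * exp (- \<rho> * L) ^ n" if "\<bar>v\<bar> \<ge> L * real n - \<bar>u\<bar>" for v
  proof -
    have "gamma_kernel \<sigma> v \<le> exp ((\<sigma> + \<rho>)\<^sup>2 / 2) * exp (- (\<rho> * \<bar>v\<bar>))"
      using \<rho> assms by (intro gamma_kernel_decay) auto
    also have "\<dots> \<le> exp ((\<sigma> + \<rho>)\<^sup>2 / 2) * exp (\<rho> * \<bar>u\<bar> + real n * (- \<rho> * L))"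
    proof -
      have "\<rho> * (L * real n - \<bar>u\<bar>) \<le> \<rho> * \<bar>v\<bar>" using that \<rho> by (intro mult_left_mono) auto
      then show ?thesis by (simp add: algebra_simps)
    qed
    finally show ?thesis unfolding exp_add exp_of_nat_mult mult.assoc .
  qed
  have "L * (x + real n) \<ge> L * real n" "L * (real (Suc n) - x) \<ge> L * real n"
    using assms L by (auto intro!: mult_left_mono)
  then show "gamma_kernel \<sigma> (u + L * (x + real n)) \<le> exp ((\<sigma> + \<rho>)\<^sup>2 / 2) * exp (\<rho> * \<bar>u\<bar>) * exp (- \<rho> * L) ^ n"
    "gamma_kernel \<sigma> (u + L * (x - real (Suc n))) \<le> exp ((\<sigma> + \<rho>)\<^sup>2 / 2) * exp (\<rho> * \<bar>u\<bar>) * exp (- \<rho> * L) ^ n"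
    by (intro *; simp add: algebra_simps abs_if; linarith)+
qed

lemma shift_pair_bound:
  assumes "x \<in> {0..1}" "\<rho> \<le> \<sigma>"
  shows "\<bar>shift_pair \<sigma> L u n x\<bar> \<le> 2 * exp ((\<sigma> + \<rho>)\<^sup>2 / 2) * exp (\<rho> * \<bar>u\<bar>) * exp (- \<rho> * L) ^ n"
  using kernel_bound_at_shift[OF assms, of n]
    gamma_kernel_pos[of \<sigma> "u + L * (x + real n)"] gamma_kernel_pos[of \<sigma> "u + L * (x - real (Suc n))"]
  unfolding shift_pair_def by linarith

lemma summable_geometric_bound: "summable (\<lambda>n. c * exp (- \<rho> * L) ^ n)"
  using \<rho> L by (intro summable_mult summable_geometric) simp

lemma shift_pair_sums:
  assumes "x \<in> {0..1}"
  shows "(\<lambda>n. shift_pair \<rho> L u n x) sums periodized_kernel \<rho> L u x"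
  unfolding periodized_kernel_def
  by (intro summable_sums summable_comparison_test'[OF summable_geometric_bound])
    (use shift_pair_bound[OF assms order_refl] in simp)

lemma uniform_limit_shift_pair:
  assumes "\<rho> \<le> \<sigma>"
  shows "uniform_limit {0..1} (\<lambda>N x. \<Sum>n<N. shift_pair \<sigma> L u n x) (\<lambda>x. \<Sum>n. shift_pair \<sigma> L u n x) sequentially"
  by (rule Weierstrass_m_test[OF _ summable_geometric_bound])
    (use shift_pair_bound[OF _ assms] in simp)

text \<open>
  The derivative of the kernel is a combination of the kernels for \<open>\<rho>\<close> and \<open>\<rho> + 1\<close>, so the series of
  derivatives has the same kind of geometric majorant. This is where the bounds are needed for a
  second parameter \<open>\<sigma>\<close>.
\<close>

lemma periodized_kernel_differentiable:
  obtains d where "\<And>x. x \<in> {0..1} \<Longrightarrow> (periodized_kernel \<rho> L u has_field_derivative d x) (at x within {0..1})"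
proof -
  define d where "d n x = L * (\<rho> * shift_pair \<rho> L u n x - shift_pair (\<rho> + 1) L u n x)" for n x
  have D: "(shift_pair \<rho> L u n has_field_derivative d n x) (at x within {0..1})" for n x
    unfolding shift_pair_def d_def
    by (auto intro!: derivative_eq_intros DERIV_chain2[OF gamma_kernel_has_derivative] simp: algebra_simps)
  have lim: "uniform_limit {0..1} (\<lambda>N x. \<Sum>n<N. d n x) (\<lambda>x. \<Sum>n. d n x) sequentially"
  proof (rule Weierstrass_m_test[OF _ summable_geometric_bound])
    fix n and x :: real assume x: "x \<in> {0..1}"
    have "\<bar>d n x\<bar> \<le> L * (\<rho> * \<bar>shift_pair \<rho> L u n x\<bar> + \<bar>shift_pair (\<rho> + 1) L u n x\<bar>)"
      using L \<rho> abs_triangle_ineq4[of "\<rho> * shift_pair \<rho> L u n x" "shift_pair (\<rho> + 1) L u n x"]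
      by (simp add: d_def abs_mult)
    also have "\<dots> \<le> L * (\<rho> * (2 * exp ((\<rho> + \<rho>)\<^sup>2 / 2) * exp (\<rho> * \<bar>u\<bar>) * exp (- \<rho> * L) ^ n)
        + 2 * exp ((\<rho> + 1 + \<rho>)\<^sup>2 / 2) * exp (\<rho> * \<bar>u\<bar>) * exp (- \<rho> * L) ^ n)"
      using L \<rho> x by (intro mult_left_mono add_mono shift_pair_bound) auto
    also have "\<dots> = (L * (\<rho> * 2 * exp ((\<rho> + \<rho>)\<^sup>2 / 2) * exp (\<rho> * \<bar>u\<bar>)
        + 2 * exp ((\<rho> + 1 + \<rho>)\<^sup>2 / 2) * exp (\<rho> * \<bar>u\<bar>))) * exp (- \<rho> * L) ^ n"
      by (simp add: algebra_simps)
    finally show "norm (d n x) \<le> \<dots>" by simp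
  qed
  obtain g where g: "\<And>x. x \<in> {0..1} \<Longrightarrow> (\<lambda>n. shift_pair \<rho> L u n x) sums g x"
      "\<And>x. x \<in> {0..1} \<Longrightarrow> (g has_field_derivative (\<Sum>n. d n x)) (at x within {0..1})"
    using has_field_derivative_series[OF convex_real_interval(5) D lim, of 0]
      sums_summable[OF shift_pair_sums[of 0]] by (metis atLeastAtMost_iff order_refl zero_le_one)
  have "(periodized_kernel \<rho> L u has_field_derivative (\<Sum>n. d n x)) (at x within {0..1})" if "x \<in> {0..1}" for x
  proof (rule has_field_derivative_transform_within[OF g(2)[OF that] zero_less_one that])
    fix y :: real assume "y \<in> {0..1}"
    then show "g y = periodized_kernel \<rho> L u y" using g(1) shift_pair_sums sums_unique2 by blast
  qed
  then show thesis by (rule that)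
qed

text \<open>
  Periodicity is not visible in the one-sided arrangement of the sum: the two series differ by a
  telescoping series, whose terms vanish at infinity.
\<close>

lemma periodized_kernel_endpoints: "periodized_kernel \<rho> L u 1 = periodized_kernel \<rho> L u 0"
proof -
  define A where "A n = gamma_kernel \<rho> (u + L * real n) - gamma_kernel \<rho> (u - L * real n)" for n
  have lim0: "(\<lambda>n. c * exp (- \<rho> * L) ^ n) \<longlonglongrightarrow> 0" for c
    by (rule summable_LIMSEQ_zero[OF summable_geometric_bound])
  have 1: "(\<lambda>n. gamma_kernel \<rho> (u + L * (0 + real n))) \<longlonglongrightarrow> 0"
    by (rule tendsto_sandwich[OF always_eventually always_eventually tendsto_const lim0[of "exp ((\<rho> + \<rho>)\<^sup>2 / 2) * exp (\<rho> * \<bar>u\<bar>)"]];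
      intro allI less_imp_le[OF gamma_kernel_pos] kernel_bound_at_shift(1)) auto
  have 2: "(\<lambda>n. gamma_kernel \<rho> (u + L * (1 - real (Suc n)))) \<longlonglongrightarrow> 0"
    by (rule tendsto_sandwich[OF always_eventually always_eventually tendsto_const lim0[of "exp ((\<rho> + \<rho>)\<^sup>2 / 2) * exp (\<rho> * \<bar>u\<bar>)"]];
      intro allI less_imp_le[OF gamma_kernel_pos] kernel_bound_at_shift(2)) auto
  have "A \<longlonglongrightarrow> 0"
    using tendsto_diff[OF 1 2] by (simp add: A_def[abs_def])
  then have "(\<lambda>n. A (Suc n) - A n) sums (0 - A 0)" by (rule telescope_sums)
  moreover have "(\<lambda>n. shift_pair \<rho> L u n 1 - shift_pair \<rho> L u n 0)
      sums (periodized_kernel \<rho> L u 1 - periodized_kernel \<rho> L u 0)"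
    by (intro sums_diff shift_pair_sums) auto
  moreover have "shift_pair \<rho> L u n 1 - shift_pair \<rho> L u n 0 = A (Suc n) - A n" for n
    by (simp add: shift_pair_def A_def algebra_simps)
  ultimately have "periodized_kernel \<rho> L u 1 - periodized_kernel \<rho> L u 0 = 0 - A 0"
    using sums_unique2 by simp
  then show ?thesis by (simp add: A_def)
qed

text \<open>
  Unfolding the periodization gives the Fourier transform of the kernel over the whole line, and the
  substitution \<open>y = exp (u + L x)\<close> turns it into the Gamma integral with complex exponent.
\<close>

lemma fourier_coeff_periodized_kernel:
  "fourier_coeff (\<lambda>x. of_real (periodized_kernel \<rho> L u x)) l
     = cis (2 * pi * of_int l * u / L) / of_real L * Gamma (of_real \<rho> - 2 * of_real pi * \<i> * of_int l / of_real L)"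
proof -
  define z where "z = complex_of_real \<rho> - 2 * of_real pi * \<i> * of_int l / of_real L"
  have z: "Re z > 0" using \<rho> by (simp add: z_def)
  define f where "f t = complex_of_real t powr (z - 1) / of_real (exp t)" for t
  define c where "c = cis (2 * pi * of_int l * u / L) / of_real L"
  define S where "S N x = complex_of_real (\<Sum>n<N. shift_pair \<rho> L u n x) * wave (- l) x" for N x
  have uS: "uniform_limit {0..1} S (\<lambda>x. of_real (periodized_kernel \<rho> L u x) * wave (- l) x) sequentially"
  proof -
    have "uniform_limit {0..1} (\<lambda>N x. complex_of_real (\<Sum>n<N. shift_pair \<rho> L u n x))
        (\<lambda>x. complex_of_real (periodized_kernel \<rho> L u x)) sequentially"
      unfolding periodized_kernel_def
      by (rule bounded_linear.uniform_limit[OF bounded_linear_of_real uniform_limit_shift_pair[OF order_refl]])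
    then show ?thesis
      unfolding uniform_limit_iff S_def
      by (simp only: dist_norm left_diff_distrib[symmetric] norm_mult norm_wave mult_1_right)
  qed
  have cS: "continuous_on {0..1} (S N)" for N
    unfolding S_def shift_pair_def by (intro continuous_intros)
  obtain I J where IJ: "\<And>N. (S N has_integral I N) {0..1}"
      "((\<lambda>x. of_real (periodized_kernel \<rho> L u x) * wave (- l) x) has_integral J) {0..1}" "I \<longlonglongrightarrow> J"
    by (rule uniform_limit_integral[OF uS cS]) auto
  have J: "fourier_coeff (\<lambda>x. of_real (periodized_kernel \<rho> L u x)) l = J"
    unfolding fourier_coeff_def using IJ(2) by (rule integral_unique)
  have I: "I N = c * integral {exp (u - L * real N)..exp (u + L * real N)} f" for N
  proof -
    define g where "g x = exp (u + L * x)" for x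
    have img: "g ` {- real N..real N} \<subseteq> {exp (u - L * real N)..exp (u + L * real N)}"
    proof (rule image_subsetI)
      fix x assume "x \<in> {- real N..real N}"
      then have "L * - real N \<le> L * x" "L * x \<le> L * real N"
        using L by (simp_all only: mult_left_mono less_imp_le atLeastAtMost_iff)
      then show "g x \<in> {exp (u - L * real N)..exp (u + L * real N)}" by (simp add: g_def)
    qed
    have pos: "0 < t" if "exp (u - L * real N) \<le> t" for t
      using less_le_trans[OF exp_gt_zero that] .
    have cont: "continuous_on {exp (u - L * real N)..exp (u + L * real N)} f"
      unfolding f_def
      by (intro continuous_intros) (auto simp: complex_nonpos_Reals_iff intro: less_imp_le[OF pos])
    have "((\<lambda>x. (L * g x) *\<^sub>R f (g x)) has_integral integral {g (- real N)..g (real N)} f) {- real N..real N}"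
      by (rule has_integral_substitution[OF _ _ img cont])
        (use L in \<open>auto simp: g_def[abs_def] intro!: derivative_eq_intros\<close>)
    then have "((\<lambda>x. c * ((L * g x) *\<^sub>R f (g x))) has_integral c * integral {g (- real N)..g (real N)} f) {- real N..real N}"
      by (rule has_integral_mult_right)
    moreover have "c * ((L * g x) *\<^sub>R f (g x)) = of_real (gamma_kernel \<rho> (u + L * x)) * wave (- l) x" for x
    proof -
      define v where "v = u + L * x"
      have "of_real (g x) powr (z - 1) = exp ((z - 1) * of_real v)"
        by (simp add: g_def v_def powr_def Ln_of_real exp_of_real[symmetric])
      then have "(L * g x) *\<^sub>R f (g x) = of_real L * (exp (of_real v) * exp ((z - 1) * of_real v) * exp (- of_real (exp v)))"
        by (simp add: f_def g_def v_def[symmetric] scaleR_conv_of_real exp_minus exp_of_real divide_inverse)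
      also have "exp (of_real v) * exp ((z - 1) * of_real v) * exp (- of_real (exp v))
          = exp (of_real (\<rho> * v - exp v) - 2 * of_real pi * \<i> * of_int l / of_real L * of_real v)"
        by (simp add: exp_add[symmetric] z_def algebra_simps)
      also have "\<dots> = of_real (gamma_kernel \<rho> v) * cis (- (2 * pi * of_int l / L * v))"
        by (simp only: gamma_kernel_def exp_diff cis_conv_exp exp_of_real of_real_minus of_real_mult of_real_divide of_real_inverse of_real_numeral of_real_of_int_eq mult_minus_right exp_minus divide_inverse mult_ac)
      also have "cis (- (2 * pi * of_int l / L * v)) = cis (- (2 * pi * of_int l * u / L)) * wave (- l) x"
      proof -
        have "- (2 * pi * of_int l / L * v) = - (2 * pi * of_int l * u / L) + 2 * pi * of_int (- l) * x"
          using L by (simp add: v_def field_simps)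
        then show ?thesis by (simp only: wave_def cis_mult)
      qed
      finally show ?thesis
        using L by (simp add: c_def v_def cis_mult[symmetric] mult_ac)
          (simp add: cis_mult mult.assoc[symmetric])
    qed
    ultimately have "((\<lambda>x. of_real (gamma_kernel \<rho> (u + L * x)) * wave (- l) x) has_integral
        c * integral {exp (u - L * real N)..exp (u + L * real N)} f) {- real N..real N}"
      by (simp add: g_def)
    then have "integral {0..1} (S N) = c * integral {exp (u - L * real N)..exp (u + L * real N)} f"
      unfolding S_def integral_partial_periodization by (rule integral_unique)
    then show ?thesis using IJ(1)[of N] by (simp add: integral_unique)
  qed
  have "(\<lambda>N. integral {exp (u - L * real N)..exp (u + L * real N)} f) \<longlonglongrightarrow> Gamma z"
    unfolding f_def
  proof (rule truncated_Gamma_integral_tendsto[OF z])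
    have top: "filterlim (\<lambda>N. L * real N) at_top sequentially"
      using L by (intro filterlim_tendsto_pos_mult_at_top[OF tendsto_const _ filterlim_real_sequentially])
    show "filterlim (\<lambda>N. exp (u + L * real N)) at_top sequentially"
      by (intro filterlim_compose[OF exp_at_top] filterlim_tendsto_add_at_top[OF tendsto_const top])
    have "filterlim (\<lambda>N. u - L * real N) at_bot sequentially"
      unfolding filterlim_uminus_at_top[of "\<lambda>N. u - L * real N"] filterlim_uminus_at_bot
      using filterlim_tendsto_add_at_top[OF tendsto_const top, of "- u"] by simp
    then show "(\<lambda>N. exp (u - L * real N)) \<longlonglongrightarrow> 0"
      by (rule filterlim_compose[OF exp_at_bot])
  qed simp
  then have "I \<longlonglongrightarrow> c * Gamma z"
    unfolding I[abs_def] by (intro tendsto_mult tendsto_const)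
  then show ?thesis
    unfolding J z_def[symmetric] c_def[symmetric] using IJ(3) LIMSEQ_unique by blast
qed

end

text \<open>
  The coefficients for \<open>l\<close> and \<open>- l\<close> are complex conjugates, so their sum is twice a real part; writing
  the value of the Gamma function in polar form gives amplitude and phase of the cosine.
\<close>

lemma fourier_coeff_pair_eq_cosine_term:
  assumes L_def: "L = ln \<beta>"
    and L: "L > 0" and \<rho>: "varrho \<alpha> \<beta> > 0"
  shows "fourier_coeff (\<lambda>x. of_real (periodized_kernel (varrho \<alpha> \<beta>) L u x)) (int l)
      + fourier_coeff (\<lambda>x. of_real (periodized_kernel (varrho \<alpha> \<beta>) L u x)) (- int l)
    = of_real (Gamma (varrho \<alpha> \<beta>) / L * (c_coeff \<alpha> \<beta> l * cos (2 * pi * real l * (u / L) - d_coeff \<alpha> \<beta> l)))"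
proof -
  define \<rho> where "\<rho> = varrho \<alpha> \<beta>"
  define g where "g = gamma_coeff \<alpha> \<beta> l"
  define \<theta> where "\<theta> = 2 * pi * real l * (u / L)"
  have \<rho>0: "\<rho> > 0" using \<rho> by (simp add: \<rho>_def)
  have g: "g = Gamma (of_real \<rho> - 2 * of_real pi * \<i> * of_int (- int l) / of_real L)"
    by (simp add: g_def gamma_coeff_def \<rho>_def L_def)
  have cg: "cnj g = Gamma (of_real \<rho> - 2 * of_real pi * \<i> * of_int (int l) / of_real L)"
    by (simp add: g cnj_Gamma)
  have g_polar: "g = of_real (cmod g) * cis (Arg g)"
    using rcis_cmod_Arg[of g] by (simp add: rcis_def)
  have 1: "fourier_coeff (\<lambda>x. of_real (periodized_kernel \<rho> L u x)) (int l) = cis \<theta> / of_real L * cnj g"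
    unfolding fourier_coeff_periodized_kernel[OF \<rho>0 L] cg[symmetric] by (simp add: \<theta>_def)
  have 2: "fourier_coeff (\<lambda>x. of_real (periodized_kernel \<rho> L u x)) (- int l) = cis (- \<theta>) / of_real L * g"
    unfolding fourier_coeff_periodized_kernel[OF \<rho>0 L] g[symmetric] by (simp add: \<theta>_def)
  have "cis \<theta> / of_real L * cnj g + cis (- \<theta>) / of_real L * g = of_real (2 * Re (cis (- \<theta>) * g) / L)"
    by (simp add: complex_eq_iff cis.ctr add_divide_distrib[symmetric] algebra_simps)
  also have "cis (- \<theta>) * g = of_real (cmod g) * cis (Arg g - \<theta>)"
    by (subst g_polar) (simp add: cis_mult mult.left_commute)
  also have "2 * Re (of_real (cmod g) * cis (Arg g - \<theta>)) / L = 2 * cmod g / L * cos (\<theta> - Arg g)"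
    by (simp add: cos_diff)
  also have "\<dots> = Gamma \<rho> / L * (c_coeff \<alpha> \<beta> l * cos (\<theta> - d_coeff \<alpha> \<beta> l))"
    using Gamma_real_pos[OF \<rho>0] by (simp add: c_coeff_def d_coeff_def g_def \<rho>_def)
  finally show ?thesis unfolding \<rho>_def[symmetric] 1 2 by (simp add: \<theta>_def)
qed

text \<open>
  Poisson summation: the Fourier series of the periodized kernel, evaluated at \<open>0\<close>, is the bracket in
  the definition of \<open>g\<close> up to the factor \<open>Gamma \<rho> / ln \<beta>\<close>, which is the constant coefficient.
\<close>

lemma g_fun_eq_periodized_kernel:
  assumes L: "ln \<beta> > 0" and \<rho>: "varrho \<alpha> \<beta> > 0"
  shows "g_fun \<alpha> \<beta> s = (\<beta> - 1) / \<beta> * (1 - \<alpha>) * (2 * \<beta> / (\<beta> - 1)\<^sup>2) powr varrho \<alpha> \<beta>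
     * periodized_kernel (varrho \<alpha> \<beta>) (ln \<beta>) (ln s) 0"
proof -
  define \<rho> where "\<rho> = varrho \<alpha> \<beta>"
  define L where "L = ln \<beta>"
  define P where "P = periodized_kernel \<rho> L (ln s)"
  define F where "F x = complex_of_real (P x)" for x
  define a where "a j = c_coeff \<alpha> \<beta> (Suc j) * cos (2 * pi * real (Suc j) * (ln s / L) - d_coeff \<alpha> \<beta> (Suc j))" for j
  have \<rho>0: "\<rho> > 0" and L0: "L > 0" using assms by (simp_all add: \<rho>_def L_def)
  have G: "Gamma \<rho> > 0" by (rule Gamma_real_pos[OF \<rho>0])
  obtain d where d: "\<And>x. x \<in> {0..1} \<Longrightarrow> (P has_field_derivative d x) (at x within {0..1})"
    using periodized_kernel_differentiable[OF \<rho>0 L0] unfolding P_def by blast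
  have dF: "(F has_vector_derivative of_real (d x)) (at x within {0..1})" if "x \<in> {0..1}" for x
    unfolding F_def by (intro has_vector_derivative_of_real) (use d[OF that] in \<open>simp add: has_real_derivative_iff_has_vector_derivative\<close>)
  have "(\<lambda>n. fourier_coeff F (int (Suc n)) + fourier_coeff F (- int (Suc n))) sums (F 0 - fourier_coeff F 0)"
  proof (rule fourier_series_converges_at_endpoint)
    show "continuous_on {0..1} F"
      by (auto simp: continuous_on_eq_continuous_within intro: has_vector_derivative_continuous dF)
    show "F 1 = F 0" using periodized_kernel_endpoints[OF \<rho>0 L0] by (simp add: F_def P_def)
  qed (rule dF; simp)+
  moreover have "fourier_coeff F (int (Suc n)) + fourier_coeff F (- int (Suc n)) = of_real (Gamma \<rho> / L * a n)" for n
    unfolding F_def P_def a_def \<rho>_def L_def by (rule fourier_coeff_pair_eq_cosine_term[OF refl L \<rho>])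
  moreover have "F 0 - fourier_coeff F 0 = of_real (P 0 - Gamma \<rho> / L)"
    unfolding F_def P_def fourier_coeff_periodized_kernel[OF \<rho>0 L0] by (simp add: Gamma_complex_of_real)
  ultimately have "(\<lambda>n. Gamma \<rho> / L * a n) sums (P 0 - Gamma \<rho> / L)"
    by (simp only: sums_of_real_iff)
  then have "(\<lambda>n. L / Gamma \<rho> * (Gamma \<rho> / L * a n)) sums (L / Gamma \<rho> * (P 0 - Gamma \<rho> / L))"
    by (rule sums_mult)
  then have "a sums (L / Gamma \<rho> * P 0 - 1)"
    using G L0 by (simp add: right_diff_distrib)
  then have "1 + suminf a = L / Gamma \<rho> * P 0" by (simp add: sums_unique[symmetric])
  have "g_fun \<alpha> \<beta> s = (\<beta> - 1) / \<beta> * ((1 - \<alpha>) * Gamma \<rho> / L) * (2 * \<beta> / (\<beta> - 1)\<^sup>2) powr \<rho> * (1 + suminf a)"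
    unfolding g_fun_def Let_def a_def \<rho>_def L_def ..
  also have "\<dots> = (\<beta> - 1) / \<beta> * ((1 - \<alpha>) * Gamma \<rho> / L) * (2 * \<beta> / (\<beta> - 1)\<^sup>2) powr \<rho> * (L / Gamma \<rho> * P 0)"
    unfolding \<open>1 + suminf a = _\<close> ..
  also have "\<dots> = (\<beta> - 1) / \<beta> * (1 - \<alpha>) * (2 * \<beta> / (\<beta> - 1)\<^sup>2) powr \<rho> * P 0"
    using G L0 by simp
  finally show ?thesis by (simp add: \<rho>_def L_def P_def)
qed

lemma summable_kernel_shifts:
  assumes \<rho>: "\<rho> > 0" and L: "L > 0"
  shows "summable (\<lambda>n. gamma_kernel \<rho> (u + L * real n))" "summable (\<lambda>n. gamma_kernel \<rho> (u - L * real n))"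
proof -
  show "summable (\<lambda>n. gamma_kernel \<rho> (u + L * real n))"
    by (rule summable_comparison_test'[OF summable_geometric_bound[OF assms]])
      (use kernel_bound_at_shift(1)[OF assms, of 0 \<rho> u] less_imp_le[OF gamma_kernel_pos] in simp)
  have "summable (\<lambda>n. gamma_kernel \<rho> (u + L * (0 - real (Suc n))))"
    by (rule summable_comparison_test'[OF summable_geometric_bound[OF assms]])
      (use kernel_bound_at_shift(2)[OF assms, of 0 \<rho> u] less_imp_le[OF gamma_kernel_pos] in simp)
  then have "summable (\<lambda>n. gamma_kernel \<rho> (u - L * real (Suc n)))" by (simp add: algebra_simps)
  then show "summable (\<lambda>n. gamma_kernel \<rho> (u - L * real n))" by (subst (asm) summable_Suc_iff)
qed

text \<open>
  The one-sided sum lacks the values at \<open>u + L n\<close> with \<open>n \<ge> 1\<close>. For \<open>u \<ge> 0\<close> these are in the region where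
  the kernel is already small.
\<close>

lemma one_sided_kernel_sum:
  assumes \<rho>: "\<rho> > 0" and L: "L > 0" and u: "u \<ge> 0"
  shows "\<bar>(\<Sum>k. gamma_kernel \<rho> (u - L * real k)) - periodized_kernel \<rho> L u 0\<bar>
    \<le> exp (2 * \<rho>\<^sup>2) / (1 - exp (- \<rho> * L)) * exp (- (\<rho> * u))"
proof -
  define A where "A n = gamma_kernel \<rho> (u + L * real n)" for n
  define B where "B n = gamma_kernel \<rho> (u - L * real n)" for n
  have S: "summable A" "summable B" using summable_kernel_shifts[OF \<rho> L] by (simp_all add: A_def[abs_def] B_def[abs_def])
  have "shift_pair \<rho> L u n 0 = A n + B (Suc n)" for n
    by (simp add: shift_pair_def A_def B_def algebra_simps)
  then have "periodized_kernel \<rho> L u 0 = suminf A + (\<Sum>n. B (Suc n))"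
    using S unfolding periodized_kernel_def by (simp add: suminf_add summable_Suc_iff)
  also have "\<dots> = (A 0 + (\<Sum>n. A (Suc n))) + (suminf B - B 0)"
    using S by (simp add: suminf_split_head)
  finally have eq: "suminf B - periodized_kernel \<rho> L u 0 = - (\<Sum>n. A (Suc n))" by (simp add: A_def B_def)
  define q where "q = exp (- \<rho> * L)"
  have q: "0 < q" "q < 1" using \<rho> L by (auto simp: q_def)
  have bound: "A (Suc n) \<le> exp (2 * \<rho>\<^sup>2) * exp (- (\<rho> * u)) * q ^ n" for n
  proof -
    have "A (Suc n) \<le> exp ((\<rho> + \<rho>)\<^sup>2 / 2) * exp (- (\<rho> * \<bar>u + L * real (Suc n)\<bar>))"
      unfolding A_def using \<rho> by (intro gamma_kernel_decay) auto
    also have "\<bar>u + L * real (Suc n)\<bar> = u + L * real (Suc n)" using u L by simp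
    also have "exp ((\<rho> + \<rho>)\<^sup>2 / 2) = exp (2 * \<rho>\<^sup>2)" by (simp add: power2_eq_square algebra_simps)
    also have "exp (- (\<rho> * (u + L * real (Suc n)))) = exp (- (\<rho> * u)) * q ^ Suc n"
      by (simp only: q_def exp_of_nat_mult[symmetric] exp_add[symmetric]) (simp add: algebra_simps)
    also have "exp (2 * \<rho>\<^sup>2) * (exp (- (\<rho> * u)) * q ^ Suc n) \<le> exp (2 * \<rho>\<^sup>2) * (exp (- (\<rho> * u)) * q ^ n)"
      using q by (intro mult_left_mono power_decreasing) auto
    finally show ?thesis by (simp add: mult.assoc)
  qed
  have pos: "0 \<le> A n" for n unfolding A_def by (rule less_imp_le[OF gamma_kernel_pos])
  have "(\<Sum>n. A (Suc n)) \<le> (\<Sum>n. exp (2 * \<rho>\<^sup>2) * exp (- (\<rho> * u)) * q ^ n)"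
    using S q by (intro suminf_le bound) (auto simp: summable_Suc_iff intro!: summable_mult summable_geometric)
  also have "\<dots> = exp (2 * \<rho>\<^sup>2) / (1 - q) * exp (- (\<rho> * u))"
    using q by (subst suminf_mult) (auto simp: suminf_geometric summable_geometric)
  finally have "(\<Sum>n. A (Suc n)) \<le> exp (2 * \<rho>\<^sup>2) / (1 - q) * exp (- (\<rho> * u))" .
  moreover have "0 \<le> (\<Sum>n. A (Suc n))" using S pos by (intro suminf_nonneg) (auto simp: summable_Suc_iff)
  ultimately show ?thesis using eq by (simp add: B_def[abs_def] q_def)
qed

text \<open>
  Some shift moves \<open>u\<close> into \<open>[0, L]\<close>, where the kernel is at least \<open>exp (- exp L)\<close>. The other terms
  are positive.
\<close>

lemma periodized_kernel_lower_bound: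
  assumes \<rho>: "\<rho> > 0" and L: "L > 0" and u: "u \<ge> 0"
  shows "exp (- exp L) \<le> periodized_kernel \<rho> L u 0"
proof -
  \<comment> \<open>The shift that moves \<open>u\<close> into one period.\<close>
  define k where "k = nat \<lfloor>u / L\<rfloor>"
  have "real k \<le> u / L" "u / L < real k + 1" using u L unfolding k_def by (simp_all add: of_nat_nat)
  then have v: "0 \<le> u - L * real k" "u - L * real k \<le> L" using L by (auto simp: field_simps)
  have "exp (- exp L) \<le> gamma_kernel \<rho> (u - L * real k)"
  proof -
    have "0 \<le> \<rho> * (u - L * real k)" using v \<rho> by simp
    moreover have "exp (u - L * real k) \<le> exp L" using v by simp
    ultimately have "- exp L \<le> \<rho> * (u - L * real k) - exp (u - L * real k)" by linarith
    then show ?thesis unfolding gamma_kernel_def by simp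
  qed
  also have "\<dots> \<le> shift_pair \<rho> L u (k - 1) 0"
    using less_imp_le[OF gamma_kernel_pos] by (cases k) (auto simp: shift_pair_def algebra_simps)
  also have "\<dots> = (\<Sum>n\<in>{k - 1}. shift_pair \<rho> L u n 0)" by simp
  also have "\<dots> \<le> periodized_kernel \<rho> L u 0"
    unfolding periodized_kernel_def
    by (rule sum_le_suminf)
      (use shift_pair_sums[OF \<rho> L, of 0 u] gamma_kernel_pos in \<open>auto simp: shift_pair_def sums_iff intro!: add_pos_pos less_imp_le\<close>)
  finally show ?thesis .
qed

section \<open>The walk killed at zero\<close>

text \<open>
  The transition operator of the walk killed at \<open>0\<close>, acting on functions that vanish at \<open>0\<close>: a
  jump to \<open>0\<close> contributes \<open>f 0 = 0\<close>.
\<close>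

definition killed_step :: "real \<Rightarrow> nat \<Rightarrow> (nat \<Rightarrow> real) \<Rightarrow> nat \<Rightarrow> real" where
  "killed_step \<beta> k f l =
     (if l = 0 then 0 else if l < k then (\<beta> * f (l + 1) + f (l - 1)) / (1 + \<beta>) else f (l - 1))"

definition alive :: "nat \<Rightarrow> real" where "alive l = (if l = 0 then 0 else 1)"

text \<open>
  For \<open>1 \<le> l \<le> k\<close>, \<open>survival \<beta> k n l\<close> is the probability that the walk started in \<open>l\<close> avoids \<open>0\<close> for
  \<open>n\<close> steps.
\<close>

definition survival :: "real \<Rightarrow> nat \<Rightarrow> nat \<Rightarrow> nat \<Rightarrow> real" where
  "survival \<beta> k n = (killed_step \<beta> k ^^ n) alive"

definition exit_rate :: "real \<Rightarrow> nat \<Rightarrow> real" where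
  "exit_rate \<beta> k = (\<beta> - 1)\<^sup>2 / (2 * \<beta> ^ Suc k)"

text \<open>
  The mean hitting time of \<open>0\<close> from \<open>l\<close>, multiplied by \<open>exit_rate \<beta> k\<close>. It combines the two natural
  functions for the walk without barrier: \<open>1 - \<beta>\<^sup>-\<^sup>l\<close> is harmonic, and \<open>l (\<beta> + 1) / (\<beta> - 1)\<close> increases
  by \<open>1\<close> per step on average. The value of the exit rate is the one for which the equation
  \<open>Q h = h - exit_rate\<close> holds at the barrier as well.
\<close>

definition scaled_mean_exit :: "real \<Rightarrow> nat \<Rightarrow> nat \<Rightarrow> real" where
  "scaled_mean_exit \<beta> k l = 1 - (1 / \<beta>) ^ l - exit_rate \<beta> k * (real l * (\<beta> + 1) / (\<beta> - 1))"

lemma killed_step_zero [simp]: "killed_step \<beta> k f 0 = 0"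
  by (simp add: killed_step_def)

lemma killed_step_mono:
  assumes "\<beta> > 1" "\<And>l. l \<le> k \<Longrightarrow> f l \<le> g l" "l \<le> k"
  shows "killed_step \<beta> k f l \<le> killed_step \<beta> k g l"
  using assms unfolding killed_step_def
  by (auto intro!: divide_right_mono add_mono mult_left_mono)

lemma killed_iter_mono:
  assumes "\<beta> > 1" "\<And>l. l \<le> k \<Longrightarrow> f l \<le> g l" "l \<le> k"
  shows "(killed_step \<beta> k ^^ n) f l \<le> (killed_step \<beta> k ^^ n) g l"
  using assms(3)
proof (induction n arbitrary: l)
  case (Suc n)
  then show ?case using killed_step_mono[OF assms(1)] by simp
qed (use assms in auto)

lemma killed_iter_cong:
  assumes "\<beta> > 1" "\<And>l. l \<le> k \<Longrightarrow> f l = g l" "l \<le> k"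
  shows "(killed_step \<beta> k ^^ n) f l = (killed_step \<beta> k ^^ n) g l"
  using assms by (intro antisym killed_iter_mono) auto

lemma killed_step_linear:
  "killed_step \<beta> k (\<lambda>l. a * f l + b * g l) = (\<lambda>l. a * killed_step \<beta> k f l + b * killed_step \<beta> k g l)"
  by (rule ext) (simp add: killed_step_def add_divide_distrib algebra_simps)

lemma killed_iter_linear:
  "(killed_step \<beta> k ^^ n) (\<lambda>l. a * f l + b * g l)
     = (\<lambda>l. a * (killed_step \<beta> k ^^ n) f l + b * (killed_step \<beta> k ^^ n) g l)"
  by (induction n) (simp_all add: killed_step_linear)

lemma killed_iter_supersolution:
  assumes b: "\<beta> > 1" and c: "c \<ge> 0"
    and super: "\<And>l. l \<le> k \<Longrightarrow> killed_step \<beta> k f l \<le> c * f l" and "l \<le> k"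
  shows "(killed_step \<beta> k ^^ n) f l \<le> c ^ n * f l"
  using \<open>l \<le> k\<close>
proof (induction n arbitrary: l)
  case (Suc n)
  have "(killed_step \<beta> k ^^ Suc n) f l \<le> killed_step \<beta> k (\<lambda>l. c ^ n * f l + 0 * f l) l"
    using Suc by (simp, intro killed_step_mono[OF b]) auto
  also have "\<dots> = c ^ n * killed_step \<beta> k f l" unfolding killed_step_linear by simp
  also have "\<dots> \<le> c ^ n * (c * f l)" using c Suc.prems by (intro mult_left_mono super) auto
  finally show ?case by (simp add: mult_ac)
qed auto

lemma alive_supersolution: "\<beta> > 1 \<Longrightarrow> killed_step \<beta> k alive l \<le> alive l"
  by (auto simp: killed_step_def alive_def field_simps)

lemma survival_bounds:
  assumes "\<beta> > 1" "l \<le> k"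
  shows "0 \<le> survival \<beta> k n l" "survival \<beta> k n l \<le> 1"
proof -
  have "(killed_step \<beta> k ^^ n) alive l \<le> 1 ^ n * alive l"
    by (rule killed_iter_supersolution) (use assms alive_supersolution in auto)
  then show "survival \<beta> k n l \<le> 1" by (auto simp: survival_def alive_def split: if_splits)
  \<comment> \<open>The zero function is written as a linear combination, so that linearity evaluates its iterates.\<close>
  have "(killed_step \<beta> k ^^ n) (\<lambda>l. 0 * alive l + 0 * alive l) l \<le> (killed_step \<beta> k ^^ n) alive l"
    by (rule killed_iter_mono) (use assms in \<open>auto simp: alive_def\<close>)
  then show "0 \<le> survival \<beta> k n l"
    unfolding killed_iter_linear by (simp add: survival_def)
qed

lemma linear_over_exponential:
  fixes x :: real
  assumes "x > 1"
  shows "real k * (1 / x) ^ k \<le> 1 / (x - 1)"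
proof -
  have "1 + real k * (x - 1) \<le> x ^ k"
    using Bernoulli_inequality[of "x - 1" k] assms by simp
  then have "real k * (x - 1) \<le> x ^ k" by simp
  then show ?thesis using assms by (simp add: field_simps)
qed

lemma exp_minus_bounds:
  fixes x :: real
  assumes "0 \<le> x" "x \<le> 1"
  shows "exp (- x) \<le> 1 - x / 2" "\<bar>1 - x - exp (- x)\<bar> \<le> x\<^sup>2"
proof -
  have "1 + x \<le> exp x" by (rule exp_ge_add_one_self)
  then have 1: "exp (- x) \<le> 1 / (1 + x)"
    using assms by (simp add: exp_minus field_simps)
  have "0 \<le> x * (1 - x)" using assms by simp
  then have "1 / (1 + x) \<le> 1 - x / 2" using assms by (simp add: field_simps power2_eq_square)
  with 1 show "exp (- x) \<le> 1 - x / 2" by linarith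
  have "0 \<le> x ^ 3" using assms by simp
  then have "1 / (1 + x) \<le> 1 - x + x\<^sup>2" using assms by (simp add: field_simps power2_eq_square power3_eq_cube)
  moreover have "1 - x \<le> exp (- x)" using exp_ge_add_one_self[of "- x"] by simp
  ultimately show "\<bar>1 - x - exp (- x)\<bar> \<le> x\<^sup>2" using 1 by linarith
qed

context
  fixes \<beta> :: real
  assumes b: "\<beta> > 1"
begin

lemma exit_rate_pos: "exit_rate \<beta> k > 0"
  using b by (simp add: exit_rate_def)

lemma exit_rate_times_slope: "exit_rate \<beta> k * ((\<beta> + 1) / (\<beta> - 1)) = (\<beta>\<^sup>2 - 1) / (2 * \<beta>) * (1 / \<beta>) ^ k"
proof -
  have "\<beta>\<^sup>2 - 1 = (\<beta> - 1) * (\<beta> + 1)" by (simp add: power2_eq_square algebra_simps)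
  then show ?thesis using b by (simp add: exit_rate_def field_simps power2_eq_square)
qed

lemma scaled_mean_exit_zero [simp]: "scaled_mean_exit \<beta> k 0 = 0"
  by (simp add: scaled_mean_exit_def)

lemma killed_step_scaled_mean_exit:
  assumes "l \<le> k"
  shows "killed_step \<beta> k (scaled_mean_exit \<beta> k) l = scaled_mean_exit \<beta> k l - exit_rate \<beta> k * alive l"
proof -
  consider "l = 0" | "0 < l" "l < k" | "0 < l" "l = k" using assms by linarith
  then show ?thesis
  proof cases
    case 2
    define m where "m = l - 1"
    have l: "l = Suc m" using 2 by (simp add: m_def)
    define L where "L = exit_rate \<beta> k"
    define y where "y = (1 / \<beta>) ^ m"
    have "(\<beta> * (1 - y / \<beta> / \<beta> - L * ((real m + 2) * (\<beta> + 1) / (\<beta> - 1))) + (1 - y - L * (real m * (\<beta> + 1) / (\<beta> - 1))))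
        = (1 + \<beta>) * (1 - y / \<beta> - L * ((real m + 1) * (\<beta> + 1) / (\<beta> - 1)) - L)"
      using b by (simp add: divide_simps) algebra
    then have "(\<beta> * (1 - y / \<beta> / \<beta> - L * ((real m + 2) * (\<beta> + 1) / (\<beta> - 1))) + (1 - y - L * (real m * (\<beta> + 1) / (\<beta> - 1)))) / (1 + \<beta>)
        = (1 - y / \<beta> - L * ((real m + 1) * (\<beta> + 1) / (\<beta> - 1)) - L)"
      using b by simp
    then show ?thesis using 2
      by (simp add: l killed_step_def scaled_mean_exit_def alive_def L_def y_def add_ac)
  next
    case 3
    define m where "m = l - 1"
    have l: "l = Suc m" "k = Suc m" using 3 by (simp_all add: m_def)
    have "exit_rate \<beta> k = (\<beta> - 1)\<^sup>2 / (2 * \<beta>\<^sup>2) * (1 / \<beta>) ^ m"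
      using b by (simp add: exit_rate_def l field_simps power2_eq_square)
    then show ?thesis using b
      by (simp add: l killed_step_def scaled_mean_exit_def alive_def divide_simps power2_eq_square)
         (simp add: algebra_simps)
  qed (simp add: alive_def)
qed

text \<open>
  The increments decrease in \<open>l\<close>, and the last one, from \<open>k - 1\<close> to \<open>k\<close>, is still nonnegative.
\<close>

lemma scaled_mean_exit_nonneg:
  assumes "l \<le> k" shows "scaled_mean_exit \<beta> k l \<ge> 0"
  using assms
proof (induction l)
  case (Suc l)
  have "(1 / \<beta>) ^ k \<le> (1 / \<beta>) ^ Suc l" using b Suc.prems by (intro power_decreasing) auto
  then have 1: "(1 / \<beta>) ^ k * (\<beta> - 1) \<le> (1 / \<beta>) ^ Suc l * (\<beta> - 1)" using b by (intro mult_right_mono) auto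
  have "(\<beta>\<^sup>2 - 1) / (2 * \<beta>) \<le> \<beta> - 1"
  proof -
    have "0 \<le> (\<beta> - 1) * (\<beta> - 1)" by simp
    then show ?thesis using b by (simp add: field_simps power2_eq_square)
  qed
  then have "(\<beta>\<^sup>2 - 1) / (2 * \<beta>) * (1 / \<beta>) ^ k \<le> (\<beta> - 1) * (1 / \<beta>) ^ k"
    using b by (intro mult_right_mono) auto
  moreover have "scaled_mean_exit \<beta> k (Suc l) - scaled_mean_exit \<beta> k l
     = (1 / \<beta>) ^ Suc l * (\<beta> - 1) - exit_rate \<beta> k * ((\<beta> + 1) / (\<beta> - 1))"
  proof -
    have "1 - y / \<beta> - L * ((real l + 1) * c) - (1 - y - L * (real l * c)) = y / \<beta> * (\<beta> - 1) - L * c" for y L c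
      using b by (simp add: divide_simps) algebra
    from this[of "(1 / \<beta>) ^ l" "exit_rate \<beta> k" "(\<beta> + 1) / (\<beta> - 1)"] show ?thesis
      using b by (simp add: scaled_mean_exit_def add_ac)
  qed
  ultimately show ?case using Suc 1 unfolding exit_rate_times_slope by (simp add: mult.commute)
qed simp

lemma scaled_mean_exit_le_1: "scaled_mean_exit \<beta> k l \<le> 1"
proof -
  have "0 \<le> exit_rate \<beta> k * (real l * (\<beta> + 1) / (\<beta> - 1))" "0 \<le> (1 / \<beta>) ^ l"
    using b exit_rate_pos[of k] by auto
  then show ?thesis unfolding scaled_mean_exit_def by linarith
qed

text \<open>
  A step of a positive operator keeps \<open>h\<close> nonnegative, so \<open>h 1 - exit_rate \<ge> 0\<close>, while \<open>h 1 \<le> 1\<close>.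
\<close>

lemma exit_rate_le_1: assumes "k \<ge> 1" shows "exit_rate \<beta> k \<le> 1"
proof -
  have "killed_step \<beta> k (\<lambda>l. 0 * alive l + 0 * alive l) 1 \<le> killed_step \<beta> k (scaled_mean_exit \<beta> k) 1"
    by (rule killed_step_mono) (use assms b scaled_mean_exit_nonneg in auto)
  then show ?thesis
    using killed_step_scaled_mean_exit[of 1 k] scaled_mean_exit_le_1[of k 1] assms
    unfolding killed_step_linear by (simp add: alive_def)
qed

text \<open>
  The function \<open>alive + h\<close> lies between \<open>1\<close> and \<open>2\<close> off \<open>0\<close>, and one step decreases it by at least the exit
  rate, hence by at least the factor \<open>1 - exit_rate / 2\<close>.
\<close>

lemma survival_exponential_bound:
  assumes k: "k \<ge> 1"
  shows "survival \<beta> k n 1 \<le> 2 * exp (- (exit_rate \<beta> k * real n / 2))"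
proof -
  define L where "L = exit_rate \<beta> k"
  define f where "f l = 1 * alive l + 1 * scaled_mean_exit \<beta> k l" for l
  have L: "0 < L" "L \<le> 1" using exit_rate_pos exit_rate_le_1[OF k] by (auto simp: L_def)
  have f2: "f l \<le> 2 * alive l" for l
    using scaled_mean_exit_le_1[of k l] by (auto simp: f_def alive_def)
  have "(killed_step \<beta> k ^^ n) alive 1 \<le> (killed_step \<beta> k ^^ n) f 1"
    by (rule killed_iter_mono) (use b k scaled_mean_exit_nonneg in \<open>auto simp: f_def\<close>)
  also have "\<dots> \<le> (1 - L / 2) ^ n * f 1"
  proof (rule killed_iter_supersolution[OF b])
    fix l assume l: "l \<le> k"
    have "killed_step \<beta> k f l \<le> f l - L * alive l"
      unfolding f_def killed_step_linear
      using alive_supersolution[OF b, of k l] killed_step_scaled_mean_exit[OF l] by (simp add: L_def)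
    also have "\<dots> \<le> f l - L / 2 * f l"
      using f2[of l] mult_left_mono[OF f2[of l], of "L/2"] L by simp
    finally show "killed_step \<beta> k f l \<le> (1 - L / 2) * f l" by (simp add: algebra_simps)
  qed (use L k in auto)
  also have "\<dots> \<le> exp (- (L * real n / 2)) * 2"
  proof (rule mult_mono)
    have "(1 - L / 2) ^ n \<le> exp (- (L / 2)) ^ n"
      using L exp_ge_add_one_self[of "- (L/2)"] by (intro power_mono) auto
    then show "(1 - L / 2) ^ n \<le> exp (- (L * real n / 2))"
      by (simp add: exp_of_nat_mult[symmetric] algebra_simps)
    show "f 1 \<le> 2" using f2[of 1] by (simp add: alive_def)
    show "0 \<le> f 1" using scaled_mean_exit_nonneg[of 1 k] k by (simp add: f_def alive_def)
  qed auto
  finally show ?thesis by (simp add: survival_def L_def)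
qed

text \<open>
  An exponential weight that is large only near \<open>0\<close>. Its base \<open>\<beta>\<^sup>-\<^sup>1\<^sup>/\<^sup>2\<close> is the one that minimizes
  \<open>(\<beta> x + 1 / x) / (1 + \<beta>)\<close>, the factor by which a step away from the barrier multiplies the mean
  of \<open>x ^ l\<close>; the minimum is \<open>drift_factor\<close>, which is less than \<open>1\<close>.
\<close>

definition near_zero_weight :: "nat \<Rightarrow> real" where
  "near_zero_weight l = (if l = 0 then 0 else (1 / sqrt \<beta>) ^ l)"

definition drift_factor :: real where "drift_factor = 2 * sqrt \<beta> / (1 + \<beta>)"

lemma drift_factor_bounds: "0 < drift_factor" "drift_factor < 1"
proof -
  have "0 < (sqrt \<beta> - 1)\<^sup>2" using b by simp
  then have "2 * sqrt \<beta> < 1 + \<beta>" using b by (simp add: power2_diff)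
  then show "drift_factor < 1" using b by (simp add: drift_factor_def)
  show "0 < drift_factor" using b by (simp add: drift_factor_def add_pos_pos)
qed

lemma near_zero_weight_drift:
  assumes "l \<le> k"
  shows "killed_step \<beta> k near_zero_weight l
     \<le> drift_factor * near_zero_weight l + sqrt \<beta> * (1 / sqrt \<beta>) ^ k * alive l"
proof -
  define s where "s = sqrt \<beta>"
  have s: "s > 1" "\<beta> = s\<^sup>2" using b by (simp_all add: s_def)
  consider "l = 0" | "0 < l" "l < k" | "0 < l" "l = k" using assms by linarith
  then show ?thesis
  proof cases
    case 2
    define m where "m = l - 1"
    have l: "l = Suc m" using 2 by (simp add: m_def)
    have "killed_step \<beta> k near_zero_weight l \<le> (\<beta> * ((1/s) ^ Suc l) + (1 / s) ^ (l - 1)) / (1 + \<beta>)"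
    proof -
      have "near_zero_weight (l - 1) \<le> (1 / s) ^ (l - 1)" using b by (simp add: near_zero_weight_def s_def)
      moreover have "near_zero_weight (l + 1) = (1 / s) ^ Suc l" by (simp add: near_zero_weight_def s_def)
      moreover have "killed_step \<beta> k near_zero_weight l = (\<beta> * near_zero_weight (l + 1) + near_zero_weight (l - 1)) / (1 + \<beta>)"
        using 2 by (simp add: killed_step_def)
      ultimately show ?thesis using b by (simp add: divide_right_mono)
    qed
    also have "\<dots> = drift_factor * (1 / s) ^ l"
    proof -
      have "drift_factor = 2 * s / (1 + s\<^sup>2)" using b by (simp add: drift_factor_def s_def)
      then show ?thesis using s by (simp add: l field_simps power2_eq_square)
    qed
    also have "\<dots> \<le> drift_factor * (1 / s) ^ l + s * (1 / s) ^ k * alive l"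
      using s by (simp add: alive_def)
    finally show ?thesis using 2 unfolding near_zero_weight_def s_def[symmetric] by simp
  next
    case 3
    define m where "m = l - 1"
    have l: "l = Suc m" "k = Suc m" using 3 by (simp_all add: m_def)
    have "killed_step \<beta> k near_zero_weight l \<le> s * (1 / s) ^ k * alive l"
      using s unfolding killed_step_def near_zero_weight_def s_def[symmetric] l
      by (auto simp: alive_def)
    also have "\<dots> \<le> drift_factor * (1 / s) ^ l + s * (1 / s) ^ k * alive l"
      using s drift_factor_bounds by simp
    finally show ?thesis using 3 unfolding near_zero_weight_def s_def[symmetric] by simp
  qed (auto simp: near_zero_weight_def alive_def)
qed

text \<open>
  The drift inequality, iterated: a walk that survives for \<open>n\<close> steps is close to \<open>0\<close> only with a probability
  that is exponentially small in \<open>n\<close>, apart from the contribution of descents from the barrier.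
\<close>

lemma near_zero_weight_iter:
  assumes k: "k \<ge> 1"
  shows "(killed_step \<beta> k ^^ n) near_zero_weight 1
     \<le> drift_factor ^ n + sqrt \<beta> / (1 - drift_factor) * (1 / sqrt \<beta>) ^ k"
proof -
  define r where "r = drift_factor"
  define D where "D = sqrt \<beta> / (1 - r) * (1 / sqrt \<beta>) ^ k"
  have r: "0 < r" "r < 1" using drift_factor_bounds by (auto simp: r_def)
  have D: "D \<ge> 0" using r b by (simp add: D_def)
  have D1: "sqrt \<beta> * (1 / sqrt \<beta>) ^ k = (1 - r) * D" using r by (simp add: D_def)
  have "(killed_step \<beta> k ^^ n) near_zero_weight l \<le> r ^ n * near_zero_weight l + (1 - r ^ n) * D * alive l" if "l \<le> k" for l
    using that
  proof (induction n arbitrary: l)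
    case (Suc n)
    have rn: "r ^ n \<le> 1" using r by (simp add: power_le_one)
    have "(killed_step \<beta> k ^^ Suc n) near_zero_weight l
        \<le> killed_step \<beta> k (\<lambda>l. r ^ n * near_zero_weight l + (1 - r ^ n) * D * alive l) l"
      using Suc by (simp, intro killed_step_mono[OF b]) auto
    also have "\<dots> = r ^ n * killed_step \<beta> k near_zero_weight l + (1 - r ^ n) * D * killed_step \<beta> k alive l"
      unfolding killed_step_linear ..
    also have "\<dots> \<le> r ^ n * (r * near_zero_weight l + (1 - r) * D * alive l) + (1 - r ^ n) * D * alive l"
      using near_zero_weight_drift[OF Suc.prems] r D rn unfolding D1 r_def[symmetric]
      by (intro add_mono mult_left_mono alive_supersolution[OF b]) auto
    finally show ?case by (simp add: algebra_simps)
  qed simp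
  from this[of 1] k have "(killed_step \<beta> k ^^ n) near_zero_weight 1 \<le> r ^ n * (1 / sqrt \<beta>) + (1 - r ^ n) * D"
    by (simp add: near_zero_weight_def alive_def)
  also have "\<dots> \<le> r ^ n * 1 + 1 * D"
    using r D b by (intro add_mono mult_mono mult_left_mono) (auto simp: power_le_one)
  finally show ?thesis by (simp add: r_def D_def)
qed

text \<open>
  Of the two parts of \<open>1 - h\<close>, the harmonic one \<open>\<beta>\<^sup>-\<^sup>l\<close> is dominated by the weight, and the linear one
  is at most of order \<open>k \<beta>\<^sup>-\<^sup>k\<close>. The factor \<open>k\<close> costs half of the exponent.
\<close>

lemma mean_exit_defect:
  assumes "l \<le> k"
  shows "alive l - scaled_mean_exit \<beta> k l
    \<le> near_zero_weight l + (\<beta>\<^sup>2 - 1) / (2 * \<beta>) / (sqrt \<beta> - 1) * (1 / sqrt \<beta>) ^ k * alive l"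
proof (cases "l = 0")
  case False
  have s: "sqrt \<beta> > 1" using b by simp
  have \<beta>: "1 / \<beta> = (1 / sqrt \<beta>) * (1 / sqrt \<beta>)" using b by simp
  have "exit_rate \<beta> k * (real l * (\<beta> + 1) / (\<beta> - 1)) = exit_rate \<beta> k * ((\<beta> + 1) / (\<beta> - 1)) * real l"
    by simp
  also have "\<dots> \<le> exit_rate \<beta> k * ((\<beta> + 1) / (\<beta> - 1)) * real k"
    using assms b exit_rate_pos[of k] by (intro mult_left_mono) auto
  also have "\<dots> = (\<beta>\<^sup>2 - 1) / (2 * \<beta>) * (real k * (1 / sqrt \<beta>) ^ k) * (1 / sqrt \<beta>) ^ k"
    unfolding exit_rate_times_slope \<beta> power_mult_distrib by simp
  also have "\<dots> \<le> (\<beta>\<^sup>2 - 1) / (2 * \<beta>) * (1 / (sqrt \<beta> - 1)) * (1 / sqrt \<beta>) ^ k"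
    using b linear_over_exponential[OF s, of k]
    by (intro mult_right_mono mult_left_mono) (auto intro!: divide_nonneg_pos)
  finally have 1: "exit_rate \<beta> k * (real l * (\<beta> + 1) / (\<beta> - 1))
      \<le> (\<beta>\<^sup>2 - 1) / (2 * \<beta>) / (sqrt \<beta> - 1) * (1 / sqrt \<beta>) ^ k" by simp
  have "(1 / \<beta>) ^ l \<le> (1 / sqrt \<beta>) ^ l * 1"
    unfolding \<beta> power_mult_distrib using b by (intro mult_left_mono power_le_one) auto
  with 1 False show ?thesis
    unfolding scaled_mean_exit_def alive_def near_zero_weight_def by simp
qed (simp add: alive_def near_zero_weight_def)

lemma exit_rate_le: "exit_rate \<beta> k \<le> (\<beta> - 1)\<^sup>2 / (2 * \<beta>) * (1 / sqrt \<beta>) ^ k"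
proof -
  have \<beta>: "1 / \<beta> = (1 / sqrt \<beta>) * (1 / sqrt \<beta>)" using b by simp
  have "exit_rate \<beta> k = (\<beta> - 1)\<^sup>2 / (2 * \<beta>) * (1 / \<beta>) ^ k"
    by (simp add: exit_rate_def power_divide)
  also have "\<dots> = (\<beta> - 1)\<^sup>2 / (2 * \<beta>) * ((1 / sqrt \<beta>) ^ k * (1 / sqrt \<beta>) ^ k)"
    unfolding \<beta> power_mult_distrib ..
  also have "\<dots> \<le> (\<beta> - 1)\<^sup>2 / (2 * \<beta>) * ((1 / sqrt \<beta>) ^ k * 1)"
    using b by (intro mult_left_mono power_le_one) auto
  finally show ?thesis by simp
qed

text \<open>
  Let \<open>p n\<close> be the survival probability and \<open>a n\<close> the mean of \<open>h\<close> over the surviving paths, both started in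
  \<open>1\<close>. Then \<open>a (n + 1) = a n - L p n\<close> with \<open>L = exit_rate \<beta> k\<close>, and \<open>p n - a n\<close> is small by
  \<open>mean_exit_defect\<close> and \<open>near_zero_weight_iter\<close>. In the recursion for \<open>a\<close> this gap is multiplied
  by \<open>L\<close>, so the part of it that persists in time accumulates over the relaxation time \<open>1 / L\<close>
  to a quantity of its own size, and the part \<open>drift_factor ^ n\<close> adds up to order \<open>L\<close>.
\<close>

lemma survival_near_exponential:
  obtains C where "C > 0" "\<And>k n. k \<ge> 1 \<Longrightarrow>
    \<bar>survival \<beta> k n 1 - (1 - 1 / \<beta>) * exp (- (exit_rate \<beta> k * real n))\<bar> \<le> drift_factor ^ n + C * (1 / sqrt \<beta>) ^ k"
proof -
  define r where "r = drift_factor"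
  have r: "0 < r" "r < 1" using drift_factor_bounds by (auto simp: r_def)
  define A where "A = (\<beta>\<^sup>2 - 1) / (2 * \<beta>) / (sqrt \<beta> - 1) + sqrt \<beta> / (1 - r)"
  define B where "B = (\<beta> - 1)\<^sup>2 / (2 * \<beta>)"
  define C where "C = A + B / (1 - r) + 2 * (A + B) + B * ((\<beta> + 1) / (\<beta> - 1))"
  have "\<beta>\<^sup>2 > 1" using b by (simp add: power2_eq_square less_1_mult)
  then have A: "A > 0" using r b by (auto simp: A_def intro!: add_pos_pos)
  have B: "B > 0" using b by (simp add: B_def)
  have C: "C > 0" using A B r b unfolding C_def by (intro add_pos_pos) auto
  show thesis
  proof (rule that[OF C])
    fix k n :: nat assume k: "k \<ge> 1"
    define L where "L = exit_rate \<beta> k"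
    define z where "z = (1 / sqrt \<beta>) ^ k"
    have z: "0 \<le> z" using b by (simp add: z_def)
    have L: "0 < L" "L \<le> 1" "L \<le> B * z"
      using exit_rate_pos exit_rate_le_1[OF k] exit_rate_le by (auto simp: L_def B_def z_def)
    define a where "a n = (killed_step \<beta> k ^^ n) (scaled_mean_exit \<beta> k) 1" for n
    define p where "p n = survival \<beta> k n 1" for n
    have a_Suc: "a (Suc n) = a n - L * p n" for n
    proof -
      have "a (Suc n) = (killed_step \<beta> k ^^ n) (killed_step \<beta> k (scaled_mean_exit \<beta> k)) 1"
        by (simp add: a_def funpow_swap1)
      also have "\<dots> = (killed_step \<beta> k ^^ n) (\<lambda>l. 1 * scaled_mean_exit \<beta> k l + (- L) * alive l) 1"
        by (rule killed_iter_cong[OF b]) (use k killed_step_scaled_mean_exit in \<open>auto simp: L_def\<close>)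
      finally show ?thesis unfolding killed_iter_linear by (simp add: a_def p_def survival_def)
    qed
    have gap: "p n - a n = (killed_step \<beta> k ^^ n) (\<lambda>l. 1 * alive l + (-1) * scaled_mean_exit \<beta> k l) 1" for n
      unfolding killed_iter_linear by (simp add: a_def p_def survival_def)
    have gap_nonneg: "0 \<le> p n - a n" for n
    proof -
      have "(killed_step \<beta> k ^^ n) (\<lambda>l. 0 * alive l + 0 * alive l) 1 \<le> p n - a n"
        unfolding gap
        by (rule killed_iter_mono[OF b]) (use k in \<open>auto simp: alive_def scaled_mean_exit_le_1\<close>)
      then show ?thesis unfolding killed_iter_linear by simp
    qed
    have gap_le: "p n - a n \<le> r ^ n + A * z" for n
    proof -
      define K where "K = (\<beta>\<^sup>2 - 1) / (2 * \<beta>) / (sqrt \<beta> - 1) * z"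
      have K: "K \<ge> 0" using \<open>\<beta>\<^sup>2 > 1\<close> b z by (simp add: K_def)
      have "p n - a n \<le> (killed_step \<beta> k ^^ n) (\<lambda>l. 1 * near_zero_weight l + K * alive l) 1"
        unfolding gap by (rule killed_iter_mono[OF b])
          (use k mean_exit_defect in \<open>auto simp: K_def z_def\<close>)
      also have "\<dots> = (killed_step \<beta> k ^^ n) near_zero_weight 1 + K * p n"
        unfolding killed_iter_linear by (simp add: p_def survival_def)
      also have "\<dots> \<le> (r ^ n + sqrt \<beta> / (1 - r) * z) + K * 1"
        using near_zero_weight_iter[OF k, of n] K survival_bounds(2)[OF b, of 1 k n] k
        by (intro add_mono mult_left_mono) (auto simp: r_def z_def p_def)
      finally show ?thesis by (simp add: A_def K_def algebra_simps)
    qed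
    have a01: "0 \<le> a n" "a n \<le> 1" for n
    proof -
      have "(killed_step \<beta> k ^^ n) (\<lambda>l. 0 * alive l + 0 * alive l) 1 \<le> a n"
        unfolding a_def by (rule killed_iter_mono[OF b]) (use k scaled_mean_exit_nonneg in auto)
      then show "0 \<le> a n" unfolding killed_iter_linear by simp
      show "a n \<le> 1" using gap_nonneg[of n] survival_bounds(2)[OF b, of 1 k n] k by (simp add: p_def)
    qed
    \<comment> \<open>The persistent part of the error: \<open>D\<close> solves \<open>(1 - L / 2) D + L (A z + L) = D\<close>.\<close>
    define D where "D = 2 * (A * z + L)"
    have a_exp: "\<bar>a n - exp (- (L * real n)) * a 0\<bar> \<le> L * (\<Sum>j<n. r ^ j) + D" for n
    proof (induction n)
      case 0 then show ?case using A z L by (simp add: D_def)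
    next
      case (Suc n)
      define e where "e = exp (- L)"
      have e: "0 < e" "e \<le> 1 - L / 2" "\<bar>1 - L - e\<bar> \<le> L\<^sup>2"
        using exp_minus_bounds[of L] L by (auto simp: e_def)
      have "exp (- (L * real (Suc n))) = e * exp (- (L * real n))"
        by (simp add: e_def exp_add[symmetric] algebra_simps)
      then have "a (Suc n) - exp (- (L * real (Suc n))) * a 0
          = e * (a n - exp (- (L * real n)) * a 0) + ((1 - L - e) * a n + (- L * (p n - a n)))"
        unfolding a_Suc by (simp add: algebra_simps)
      also have "\<bar>\<dots>\<bar> \<le> e * (L * (\<Sum>j<n. r ^ j) + D) + (L\<^sup>2 * 1 + L * (r ^ n + A * z))"
      proof (intro abs_triangle_ineq[THEN order_trans] add_mono)
        show "\<bar>e * (a n - exp (- (L * real n)) * a 0)\<bar> \<le> e * (L * (\<Sum>j<n. r ^ j) + D)"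
          using Suc.IH e by (simp add: abs_mult)
        show "\<bar>(1 - L - e) * a n\<bar> \<le> L\<^sup>2 * 1"
          unfolding abs_mult using a01[of n] e by (intro mult_mono) auto
        show "\<bar>- L * (p n - a n)\<bar> \<le> L * (r ^ n + A * z)"
          unfolding abs_mult using gap_nonneg[of n] gap_le[of n] L by (intro mult_mono) auto
      qed
      also have "\<dots> \<le> (L * (\<Sum>j<n. r ^ j) + (1 - L / 2) * D) + (L\<^sup>2 + L * (r ^ n + A * z))"
      proof -
        have "e * (L * (\<Sum>j<n. r ^ j)) \<le> 1 * (L * (\<Sum>j<n. r ^ j))"
          using e L r by (intro mult_right_mono) (auto intro!: mult_nonneg_nonneg sum_nonneg)
        moreover have "e * D \<le> (1 - L / 2) * D"
          using e A z L by (intro mult_right_mono) (auto simp: D_def)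
        ultimately show ?thesis by (simp add: algebra_simps)
      qed
      also have "\<dots> = L * (\<Sum>j<Suc n. r ^ j) + D"
        by (simp add: D_def algebra_simps power2_eq_square)
      finally show ?case .
    qed
    have geo: "(\<Sum>j<n. r ^ j) \<le> 1 / (1 - r)"
      using r by (simp add: sum_gp_strict divide_right_mono)
    have a0: "a 0 = 1 - 1 / \<beta> - L * ((\<beta> + 1) / (\<beta> - 1))"
      by (simp add: a_def scaled_mean_exit_def L_def)
    define w where "w = exp (- (L * real n))"
    have w: "0 < w" "w \<le> 1" using L by (auto simp: w_def)
    have slope: "0 \<le> (\<beta> + 1) / (\<beta> - 1)" using b by simp
    have "p n - (1 - 1 / \<beta>) * w = (p n - a n) + (a n - w * a 0) - w * (L * ((\<beta> + 1) / (\<beta> - 1)))"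
      unfolding a0 by (simp add: algebra_simps)
    also have "\<bar>\<dots>\<bar> \<le> (r ^ n + A * z) + (L * (1 / (1 - r)) + D) + 1 * (L * ((\<beta> + 1) / (\<beta> - 1)))"
    proof -
      have 1: "\<bar>p n - a n\<bar> \<le> r ^ n + A * z" using gap_nonneg[of n] gap_le[of n] by simp
      have 2: "\<bar>a n - w * a 0\<bar> \<le> L * (1 / (1 - r)) + D"
        using a_exp[of n] mult_left_mono[OF geo, of L] L unfolding w_def by simp
      have 3: "\<bar>w * (L * ((\<beta> + 1) / (\<beta> - 1)))\<bar> \<le> 1 * (L * ((\<beta> + 1) / (\<beta> - 1)))"
        unfolding abs_mult[of w] using w mult_nonneg_nonneg[OF less_imp_le[OF L(1)] slope]
        by (intro mult_mono) (auto simp only: abs_of_nonneg abs_of_pos abs_ge_zero)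
      show ?thesis
        by (rule order_trans[OF abs_triangle_ineq4 add_mono[OF order_trans[OF abs_triangle_ineq add_mono[OF 1 2]] 3]])
    qed
    also have "\<dots> \<le> (r ^ n + A * z) + (B * z * (1 / (1 - r)) + 2 * (A * z + B * z)) + 1 * (B * z * ((\<beta> + 1) / (\<beta> - 1)))"
      unfolding D_def using L slope r z by (intro add_mono mult_right_mono mult_left_mono) auto
    also have "\<dots> = r ^ n + C * z" by (simp add: C_def algebra_simps)
    finally show "\<bar>survival \<beta> k n 1 - (1 - 1 / \<beta>) * exp (- (exit_rate \<beta> k * real n))\<bar>
        \<le> drift_factor ^ n + C * (1 / sqrt \<beta>) ^ k"
      by (simp add: p_def w_def L_def r_def z_def)
  qed
qed

text \<open>
  The error is at most \<open>2 exp (- L n / 2)\<close> by the crude tail bound and at most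
  \<open>drift_factor ^ n + C \<beta> powr (- k / 2)\<close> by \<open>survival_near_exponential\<close>, hence at most the geometric mean of the two.
\<close>

lemma survival_error:
  obtains C r where "C > 0" "0 < r" "r < 1" "\<And>k n. k \<ge> 1 \<Longrightarrow>
    \<bar>survival \<beta> k n 1 - (1 - 1 / \<beta>) * exp (- (exit_rate \<beta> k * real n))\<bar>
      \<le> C * exp (- (exit_rate \<beta> k * real n / 4)) * (r ^ n + (1 / sqrt (sqrt \<beta>)) ^ k)"
proof -
  obtain C where C: "C > 0" and near: "\<And>k n. k \<ge> 1 \<Longrightarrow>
    \<bar>survival \<beta> k n 1 - (1 - 1 / \<beta>) * exp (- (exit_rate \<beta> k * real n))\<bar> \<le> drift_factor ^ n + C * (1 / sqrt \<beta>) ^ k"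
    using survival_near_exponential by metis
  define r where "r = sqrt drift_factor"
  have r: "0 < r" "r < 1" using drift_factor_bounds by (auto simp: r_def)
  show thesis
  proof (rule that[of "sqrt 2 * (1 + sqrt C)" r])
    fix k n :: nat assume k: "k \<ge> 1"
    define L where "L = exit_rate \<beta> k"
    define x where "x = survival \<beta> k n 1 - (1 - 1 / \<beta>) * exp (- (L * real n))"
    define u where "u = drift_factor ^ n"
    define v where "v = (1 / sqrt \<beta>) ^ k"
    have L: "L > 0" using exit_rate_pos by (simp add: L_def)
    have uv: "0 \<le> u" "0 \<le> v" using drift_factor_bounds b by (auto simp: u_def v_def)
    have 1: "\<bar>x\<bar> \<le> u + C * v" using near[OF k, of n] by (simp add: x_def L_def u_def v_def)
    have 2: "\<bar>x\<bar> \<le> 2 * exp (- (L * real n / 2))"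
    proof -
      have "(1 - 1 / \<beta>) * exp (- (L * real n)) \<le> 1 * exp (- (L * real n / 2))"
        using b L by (intro mult_mono) auto
      moreover have "0 \<le> (1 - 1 / \<beta>) * exp (- (L * real n))" using b by simp
      moreover have "survival \<beta> k n 1 \<le> 2 * exp (- (L * real n / 2))"
        using survival_exponential_bound[OF k, of n] unfolding L_def .
      moreover have "0 \<le> survival \<beta> k n 1" by (rule survival_bounds(1)[OF b k])
      ultimately show ?thesis unfolding x_def abs_le_iff by linarith
    qed
    have prod: "\<bar>x\<bar> * \<bar>x\<bar> \<le> 2 * exp (- (L * real n / 2)) * (u + C * v)"
      by (rule mult_mono[OF 2 1]) simp_all
    have "\<bar>x\<bar> \<le> sqrt (2 * exp (- (L * real n / 2)) * (u + C * v))"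
      by (rule real_le_rsqrt) (simp only: power2_eq_square prod)
    also have "\<dots> = sqrt 2 * exp (- (L * real n / 4)) * sqrt (u + C * v)"
    proof -
      have "(exp (- (L * real n / 4)))\<^sup>2 = exp (- (L * real n / 2))"
        unfolding power2_eq_square exp_add[symmetric] by simp
      then have "sqrt (exp (- (L * real n / 2))) = exp (- (L * real n / 4))"
        by (rule real_sqrt_unique) simp
      then show ?thesis by (simp only: real_sqrt_mult)
    qed
    also have "\<dots> \<le> sqrt 2 * exp (- (L * real n / 4)) * ((1 + sqrt C) * (sqrt u + sqrt v))"
    proof (intro mult_left_mono)
      have "sqrt (u + C * v) \<le> sqrt u + sqrt C * sqrt v"
        using sqrt_add_le_add_sqrt[of u "C * v"] uv C by (simp add: real_sqrt_mult)
      also have "\<dots> \<le> (1 + sqrt C) * (sqrt u + sqrt v)"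
        using uv C by (simp add: algebra_simps)
      finally show "sqrt (u + C * v) \<le> (1 + sqrt C) * (sqrt u + sqrt v)" .
    qed auto
    also have "sqrt u = r ^ n" by (simp only: u_def r_def real_sqrt_power)
    also have "sqrt v = (1 / sqrt (sqrt \<beta>)) ^ k" by (simp only: v_def real_sqrt_power real_sqrt_divide real_sqrt_one)
    finally have bound: "\<bar>x\<bar> \<le> sqrt 2 * exp (- (L * real n / 4)) * ((1 + sqrt C) * (r ^ n + (1 / sqrt (sqrt \<beta>)) ^ k))" .
    have swap: "sqrt 2 * y * ((1 + sqrt C) * y') = sqrt 2 * (1 + sqrt C) * y * y'" for y y' :: real
      by (simp only: mult_ac)
    show "\<bar>survival \<beta> k n 1 - (1 - 1 / \<beta>) * exp (- (exit_rate \<beta> k * real n))\<bar>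
      \<le> sqrt 2 * (1 + sqrt C) * exp (- (exit_rate \<beta> k * real n / 4)) * (r ^ n + (1 / sqrt (sqrt \<beta>)) ^ k)"
      using bound unfolding swap x_def L_def .
  next
    show "0 < sqrt 2 * (1 + sqrt C)" using C by (simp add: add_pos_pos)
  qed (rule r)+
qed

end

section \<open>From the Markov chain to the killed walk\<close>

text \<open>
  The law of the first \<open>n + 1\<close> states, most recent state first, so that the head of a list
  is the current state.
\<close>

primrec history :: "(nat \<Rightarrow> nat pmf) \<Rightarrow> nat \<Rightarrow> nat \<Rightarrow> nat list pmf" where
  "history \<kappa> x0 0 = return_pmf [x0]"
| "history \<kappa> x0 (Suc n) = bind_pmf (history \<kappa> x0 n) (\<lambda>xs. map_pmf (\<lambda>y. y # xs) (\<kappa> (hd xs)))"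

primrec trajectory :: "(nat \<Rightarrow> 'w \<Rightarrow> nat) \<Rightarrow> nat \<Rightarrow> 'w \<Rightarrow> nat list" where
  "trajectory X 0 \<omega> = [X 0 \<omega>]"
| "trajectory X (Suc n) \<omega> = X (Suc n) \<omega> # trajectory X n \<omega>"

lemma length_trajectory [simp]: "length (trajectory X n \<omega>) = Suc n"
  by (induction n) auto

lemma trajectory_eq_iff:
  "trajectory X n \<omega> = xs \<longleftrightarrow> length xs = Suc n \<and> (\<forall>i\<le>n. X i \<omega> = xs ! (n - i))"
proof (induction n arbitrary: xs)
  case 0
  show ?case by (cases xs) auto
next
  case (Suc n)
  show ?case
  proof (cases xs)
    case (Cons y ys)
    show ?thesis unfolding Cons by (auto simp: Suc.IH le_Suc_eq Suc_diff_le)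
  qed simp
qed

lemma pmf_history_Suc:
  "pmf (history \<kappa> x0 (Suc n)) (y # ys) = pmf (history \<kappa> x0 n) ys * pmf (\<kappa> (hd ys)) y"
proof -
  have "pmf (history \<kappa> x0 (Suc n)) (y # ys)
      = (\<integral>zs. pmf (map_pmf (\<lambda>y. y # zs) (\<kappa> (hd zs))) (y # ys) \<partial>history \<kappa> x0 n)"
    by (simp add: pmf_bind)
  also have "\<dots> = (\<integral>zs. indicator {ys} zs * pmf (\<kappa> (hd ys)) y \<partial>history \<kappa> x0 n)"
  proof (rule Bochner_Integration.integral_cong)
    fix zs
    show "pmf (map_pmf (\<lambda>y. y # zs) (\<kappa> (hd zs))) (y # ys) = indicator {ys} zs * pmf (\<kappa> (hd ys)) y"
    proof (cases "zs = ys")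
      case True
      have "inj (\<lambda>y. y # ys)" by (simp add: inj_def)
      then show ?thesis using True pmf_map_inj'[of "\<lambda>y. y # ys" "\<kappa> (hd ys)" y] by simp
    next
      case False
      then have "y # ys \<notin> set_pmf (map_pmf (\<lambda>y. y # zs) (\<kappa> (hd zs)))" by auto
      then have "pmf (map_pmf (\<lambda>y. y # zs) (\<kappa> (hd zs))) (y # ys) = 0"
        unfolding pmf_eq_0_set_pmf .
      then show ?thesis using False by simp
    qed
  qed simp
  also have "\<dots> = pmf (history \<kappa> x0 n) ys * pmf (\<kappa> (hd ys)) y"
    by (simp add: measure_pmf_single)
  finally show ?thesis .
qed

lemma length_history: "xs \<in> set_pmf (history \<kappa> x0 n) \<Longrightarrow> length xs = Suc n"
  by (induction n arbitrary: xs) auto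

text \<open>
  The definition of a Markov chain speaks about one history at a time, which is exactly the event that
  the trajectory is a given list. If the history has probability \<open>0\<close>, both sides vanish.
\<close>

lemma trajectory_event:
  assumes "markov_chain M X x0 \<kappa>"
  shows "{\<omega> \<in> space M. trajectory X n \<omega> = xs} \<in> sets M"
    "\<P>(\<omega> in M. trajectory X n \<omega> = xs) = pmf (history \<kappa> x0 n) xs"
proof -
  interpret prob_space M using assms by (simp add: markov_chain_def)
  have X [measurable]: "X n \<in> measurable M (count_space UNIV)" for n
    using assms by (simp add: markov_chain_def)
  have ev: "{\<omega> \<in> space M. trajectory X n \<omega> = xs} \<in> sets M" for n xs
    unfolding trajectory_eq_iff by measurable
  then show "{\<omega> \<in> space M. trajectory X n \<omega> = xs} \<in> sets M" .
  show "\<P>(\<omega> in M. trajectory X n \<omega> = xs) = pmf (history \<kappa> x0 n) xs"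
  proof (induction n arbitrary: xs)
    case 0
    have ae: "AE \<omega> in M. X 0 \<omega> = x0" using assms by (simp add: markov_chain_def)
    show ?case
    proof (cases "xs = [x0]")
      case True
      then show ?thesis using ae by (simp add: prob_Collect_eq_1)
    next
      case False
      then have "AE \<omega> in M. [X 0 \<omega>] \<noteq> xs" using ae by auto
      then have "\<P>(\<omega> in M. trajectory X 0 \<omega> = xs) = 0"
        using ev[of 0 xs] by (subst prob_Collect_eq_0) auto
      then show ?thesis using False by (simp add: pmf_return)
    qed
  next
    case (Suc n)
    show ?case
    proof (cases xs)
      case Nil
      have "[] \<notin> set_pmf (history \<kappa> x0 (Suc n))" using length_history by fastforce
      then have "pmf (history \<kappa> x0 (Suc n)) [] = 0" unfolding pmf_eq_0_set_pmf .
      then show ?thesis unfolding Nil by simp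
    next
      case (Cons y ys)
      have "\<P>(\<omega> in M. X (Suc n) \<omega> = y \<and> trajectory X n \<omega> = ys) = \<P>(\<omega> in M. trajectory X n \<omega> = ys) * pmf (\<kappa> (hd ys)) y"
      proof (cases "\<P>(\<omega> in M. trajectory X n \<omega> = ys) > 0")
        case True
        then have len: "length ys = Suc n"
          by (auto simp: trajectory_eq_iff intro: ccontr)
        define x where "x i = ys ! (n - i)" for i
        have pe: "trajectory X n \<omega> = ys \<longleftrightarrow> (\<forall>i\<le>n. X i \<omega> = x i)" for \<omega>
          using len by (simp add: trajectory_eq_iff x_def)
        have "\<P>(\<omega> in M. X (Suc n) \<omega> = y \<bar> \<forall>i\<le>n. X i \<omega> = x i) = pmf (\<kappa> (x n)) y"
          using assms True unfolding pe markov_chain_def by blast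
        moreover have "x n = hd ys" using len by (cases ys) (auto simp: x_def)
        ultimately show ?thesis
          using True unfolding cond_prob_def pe by (simp add: field_simps)
      next
        case False
        then have z: "\<P>(\<omega> in M. trajectory X n \<omega> = ys) = 0" using measure_nonneg[of M] by (simp add: not_less antisym)
        have "\<P>(\<omega> in M. X (Suc n) \<omega> = y \<and> trajectory X n \<omega> = ys) \<le> \<P>(\<omega> in M. trajectory X n \<omega> = ys)"
          using ev[of n ys] by (intro finite_measure_mono) auto
        then show ?thesis using z measure_nonneg[of M] by (simp add: antisym)
      qed
      then show ?thesis unfolding Cons pmf_history_Suc Suc.IH by simp
    qed
  qed
qed

lemma emeasure_trajectory:
  assumes "markov_chain M X x0 \<kappa>"
  shows "{\<omega> \<in> space M. trajectory X n \<omega> \<in> S} \<in> sets M"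
    "emeasure M {\<omega> \<in> space M. trajectory X n \<omega> \<in> S} = emeasure (history \<kappa> x0 n) S"
proof -
  interpret prob_space M using assms by (simp add: markov_chain_def)
  have meas: "trajectory X n \<in> measurable M (count_space UNIV)"
    unfolding measurable_count_space_eq2_countable
    using trajectory_event(1)[OF assms, of n] by (auto simp: vimage_def Int_def conj_commute)
  have "distr M (count_space UNIV) (trajectory X n) = measure_pmf (history \<kappa> x0 n)"
  proof (rule measure_eqI_countable[of _ UNIV])
    fix xs :: "nat list"
    have "emeasure (distr M (count_space UNIV) (trajectory X n)) {xs} = emeasure M {\<omega> \<in> space M. trajectory X n \<omega> = xs}"
      by (subst emeasure_distr[OF meas]) (auto intro!: arg_cong[where f = "emeasure M"])
    then show "emeasure (distr M (count_space UNIV) (trajectory X n)) {xs} = emeasure (measure_pmf (history \<kappa> x0 n)) {xs}"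
      using trajectory_event(2)[OF assms, of n xs] by (simp add: emeasure_eq_measure emeasure_pmf_single)
  qed auto
  moreover have "emeasure (distr M (count_space UNIV) (trajectory X n)) S = emeasure M {\<omega> \<in> space M. trajectory X n \<omega> \<in> S}"
    by (subst emeasure_distr[OF meas]) (auto intro!: arg_cong[where f = "emeasure M"])
  ultimately show "emeasure M {\<omega> \<in> space M. trajectory X n \<omega> \<in> S} = emeasure (history \<kappa> x0 n) S" by simp
  show "{\<omega> \<in> space M. trajectory X n \<omega> \<in> S} \<in> sets M"
    using measurable_sets[OF meas, of S] by (simp add: vimage_def Int_def conj_commute)
qed

text \<open>
  The last entry of the list is the initial state \<open>0\<close>, which does not count as a return.
\<close>

definition no_return :: "nat list \<Rightarrow> bool" where
  "no_return xs \<longleftrightarrow> 0 \<notin> set (butlast xs)"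

lemma no_return_trajectory: "no_return (trajectory X n \<omega>) \<longleftrightarrow> (\<forall>i. 0 < i \<and> i \<le> n \<longrightarrow> X i \<omega> \<noteq> 0)"
proof (induction n)
  case (Suc n)
  have "trajectory X n \<omega> \<noteq> []" using length_trajectory[of X n \<omega>] by force
  then show ?case using Suc by (auto simp: no_return_def le_Suc_eq)
qed (auto simp: no_return_def)

text \<open>
  The mean of \<open>f\<close> over the current state, restricted to the paths that have not returned. It is
  a nonnegative integral, so that it can be taken step by step without integrability conditions.
\<close>

definition excursion_mass :: "(nat \<Rightarrow> nat pmf) \<Rightarrow> nat \<Rightarrow> (nat \<Rightarrow> real) \<Rightarrow> ennreal" where
  "excursion_mass \<kappa> n f = (\<integral>\<^sup>+xs. (if no_return xs then ennreal (f (hd xs)) else 0) \<partial>history \<kappa> 0 n)"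

lemma history_le_barrier:
  assumes "xs \<in> set_pmf (history (walk_step \<beta> k) 0 n)"
  shows "hd xs \<le> k"
  using assms
proof (induction n arbitrary: xs)
  case (Suc n)
  then obtain ys y where xs: "xs = y # ys" "ys \<in> set_pmf (history (walk_step \<beta> k) 0 n)" "y \<in> set_pmf (walk_step \<beta> k (hd ys))"
    by auto
  then have "hd ys \<le> k" using Suc.IH by blast
  then have "y \<le> k" using xs(3) by (auto simp: walk_step_def split: if_splits)
  then show ?case using xs by simp
qed simp

lemma nn_integral_walk_step:
  assumes b: "\<beta> > 1" and f: "\<And>l. f l \<ge> 0" and l: "0 < l" "l \<le> k"
  shows "(\<integral>\<^sup>+y. ennreal (f y) \<partial>walk_step \<beta> k l) = ennreal (killed_step \<beta> k f l)"
proof (cases "l < k")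
  case True
  have p: "0 \<le> \<beta> / (1 + \<beta>)" "\<beta> / (1 + \<beta>) \<le> 1" "1 - \<beta> / (1 + \<beta>) = 1 / (1 + \<beta>)"
    using b by (auto simp: field_simps)
  have "(\<integral>\<^sup>+y. ennreal (f y) \<partial>walk_step \<beta> k l)
      = ennreal (f (l + 1)) * ennreal (\<beta> / (1 + \<beta>)) + ennreal (f (l - 1)) * ennreal (1 - \<beta> / (1 + \<beta>))"
    using True l p by (simp add: walk_step_def)
  also have "\<dots> = ennreal (f (l + 1) * (\<beta> / (1 + \<beta>)) + f (l - 1) * (1 / (1 + \<beta>)))"
  proof -
    have split: "ennreal x * ennreal y + ennreal z * ennreal w = ennreal (x * y + z * w)"
      if "0 \<le> x" "0 \<le> y" "0 \<le> z" "0 \<le> w" for x y z w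
      using that by (simp add: ennreal_mult)
    show ?thesis unfolding p(3) by (rule split) (use f b in auto)
  qed
  also have "f (l + 1) * (\<beta> / (1 + \<beta>)) + f (l - 1) * (1 / (1 + \<beta>)) = killed_step \<beta> k f l"
    using True l by (simp add: killed_step_def add_divide_distrib mult.commute)
  finally show ?thesis .
next
  case False
  then show ?thesis using l by (simp add: walk_step_def killed_step_def)
qed

text \<open>
  Conditioning on everything but the last step. Such a step is available for the killed operator only
  after the walk has left \<open>0\<close>, hence the two successors.
\<close>

lemma excursion_mass_Suc:
  assumes b: "\<beta> > 1" and f: "\<And>l. f l \<ge> 0" "f 0 = 0"
  shows "excursion_mass (walk_step \<beta> k) (Suc (Suc n)) f = excursion_mass (walk_step \<beta> k) (Suc n) (killed_step \<beta> k f)"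
proof -
  have "excursion_mass (walk_step \<beta> k) (Suc (Suc n)) f
      = (\<integral>\<^sup>+xs. (\<integral>\<^sup>+y. (if no_return (y # xs) then ennreal (f y) else 0) \<partial>walk_step \<beta> k (hd xs)) \<partial>history (walk_step \<beta> k) 0 (Suc n))"
    unfolding excursion_mass_def by (subst history.simps(2)) (simp only: nn_integral_bind_pmf nn_integral_map_pmf list.sel)
  also have "\<dots> = excursion_mass (walk_step \<beta> k) (Suc n) (killed_step \<beta> k f)"
    unfolding excursion_mass_def
  proof (rule nn_integral_cong_AE, unfold AE_measure_pmf_iff, rule ballI)
    fix xs assume xs: "xs \<in> set_pmf (history (walk_step \<beta> k) 0 (Suc n))"
    then obtain y z ys where ys: "xs = y # z # ys"
      using length_history[OF xs] by (metis length_Suc_conv)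
    have nr: "(if no_return (v # xs) then ennreal (f v) else 0) = (if no_return xs then ennreal (f v) else 0)" for v
      using f(2) by (auto simp: no_return_def ys)
    show "(\<integral>\<^sup>+y. (if no_return (y # xs) then ennreal (f y) else 0) \<partial>walk_step \<beta> k (hd xs))
        = (if no_return xs then ennreal (killed_step \<beta> k f (hd xs)) else 0)"
    proof (cases "no_return xs")
      case True
      then have "0 < hd xs" by (auto simp: no_return_def ys)
      then show ?thesis
        unfolding nr using True nn_integral_walk_step[OF b f(1) _ history_le_barrier[OF xs]] by simp
    qed (simp add: nr)
  qed
  finally show ?thesis .
qed

lemma excursion_mass_eq:
  assumes b: "\<beta> > 1" and k: "k \<ge> 1" and f: "\<And>l. f l \<ge> 0" "f 0 = 0"
  shows "excursion_mass (walk_step \<beta> k) (Suc n) f = ennreal ((killed_step \<beta> k ^^ n) f 1)"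
  using f
proof (induction n arbitrary: f)
  case 0
  then show ?case using k by (simp add: excursion_mass_def walk_step_def no_return_def)
next
  case (Suc n)
  have "killed_step \<beta> k f l \<ge> 0" for l
    using Suc.prems(1) b by (auto simp: killed_step_def)
  then show ?case
    using Suc.IH[of "killed_step \<beta> k f"]
      excursion_mass_Suc[of \<beta> f k n] b Suc.prems by (simp add: funpow_swap1)
qed

text \<open>
  The first step leads to \<open>1\<close> with certainty, so only \<open>n\<close> of the \<open>n + 1\<close> steps are left to survive.
\<close>

lemma prob_no_return:
  assumes b: "\<beta> > 1" and k: "k \<ge> 1" and M: "markov_chain M X 0 (walk_step \<beta> k)"
  shows "emeasure M {\<omega> \<in> space M. \<forall>i. 0 < i \<and> i \<le> Suc n \<longrightarrow> X i \<omega> \<noteq> 0} = ennreal (survival \<beta> k n 1)"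
proof -
  have "emeasure M {\<omega> \<in> space M. \<forall>i. 0 < i \<and> i \<le> Suc n \<longrightarrow> X i \<omega> \<noteq> 0}
      = emeasure (history (walk_step \<beta> k) 0 (Suc n)) {xs. no_return xs}"
    using emeasure_trajectory(2)[OF M, of "Suc n" "{xs. no_return xs}"] by (simp only: mem_Collect_eq no_return_trajectory)
  also have "\<dots> = (\<integral>\<^sup>+xs. indicator {xs. no_return xs} xs \<partial>history (walk_step \<beta> k) 0 (Suc n))"
    by (rule nn_integral_indicator[symmetric]) simp
  also have "\<dots> = excursion_mass (walk_step \<beta> k) (Suc n) alive"
    unfolding excursion_mass_def
  proof (rule nn_integral_cong_AE, unfold AE_measure_pmf_iff, rule ballI)
    fix xs assume xs: "xs \<in> set_pmf (history (walk_step \<beta> k) 0 (Suc n))"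
    then obtain y z ys where "xs = y # z # ys"
      using length_history[OF xs] by (metis length_Suc_conv)
    then show "indicator {xs. no_return xs} xs = (if no_return xs then ennreal (alive (hd xs)) else 0)"
      by (auto simp: no_return_def alive_def)
  qed
  also have "\<dots> = ennreal (survival \<beta> k n 1)"
    using excursion_mass_eq[OF b k, of alive n] by (simp add: alive_def survival_def)
  finally show ?thesis .
qed

lemma excursion_length_gt_iff:
  assumes "t \<ge> 0"
  shows "ereal_of_enat (excursion_length K X \<omega>) > ereal t
    \<longleftrightarrow> K \<omega> \<noteq> 0 \<and> (\<forall>i. 0 < i \<and> i \<le> nat \<lfloor>t\<rfloor> \<longrightarrow> X i \<omega> \<noteq> 0)"
proof -
  have 1: "ereal t < ereal_of_enat e \<longleftrightarrow> enat (Suc (nat \<lfloor>t\<rfloor>)) \<le> e" for e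
  proof (cases e)
    case (enat m)
    have "t < real m \<longleftrightarrow> Suc (nat \<lfloor>t\<rfloor>) \<le> m" using assms by linarith
    then show ?thesis using enat by simp
  qed simp
  show ?thesis
  proof (cases "K \<omega> = 0")
    case True
    then show ?thesis using assms by (simp add: excursion_length_def)
  next
    case False
    then show ?thesis unfolding 1 excursion_length_def
      by (auto simp: le_INF_iff not_less_eq_eq)
  qed
qed

section \<open>The tail of the excursion length\<close>

text \<open>
  \<open>P\<^sub>k[T > t]\<close> for \<open>t \<ge> 1\<close>. For \<open>k = 0\<close> the excursion has length \<open>0\<close>, and the subtraction of \<open>1\<close> accounts
  for the deterministic first step.
\<close>

definition tail_prob :: "real \<Rightarrow> real \<Rightarrow> nat \<Rightarrow> real" where
  "tail_prob \<beta> t k = (if k = 0 then 0 else survival \<beta> k (nat \<lfloor>t\<rfloor> - 1) 1)"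

lemma tail_prob_bounds: "\<beta> > 1 \<Longrightarrow> 0 \<le> tail_prob \<beta> t k \<and> tail_prob \<beta> t k \<le> 1"
  using survival_bounds[of \<beta> 1 k] by (auto simp: tail_prob_def)

lemma prob_excursion_gt:
  assumes b: "\<beta> > 1" and a: "0 < \<alpha>" "\<alpha> < 1" and W: "biased_reflected_walk \<beta> \<Omega> P K X" and t: "t \<ge> 1"
  shows "\<P>(\<omega> in geometric_mixture \<alpha> P. ereal_of_enat (excursion_length K X \<omega>) > ereal t)
    = (\<Sum>k. (1 - \<alpha>) * \<alpha> ^ k * tail_prob \<beta> t k)"
proof -
  define n where "n = nat \<lfloor>t\<rfloor> - 1"
  have n: "nat \<lfloor>t\<rfloor> = Suc n" using t unfolding n_def by linarith
  define A where "A = {\<omega> \<in> space \<Omega>. K \<omega> \<noteq> 0 \<and> (\<forall>i. 0 < i \<and> i \<le> Suc n \<longrightarrow> X i \<omega> \<noteq> 0)}"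
  have sets: "sets (P k) = sets \<Omega>" and ae: "AE \<omega> in P k. K \<omega> = k"
    and mc: "markov_chain (P k) X 0 (walk_step \<beta> k)" for k
    using W by (auto simp: biased_reflected_walk_def)
  have sp: "space (P k) = space \<Omega>" for k using sets by (rule sets_eq_imp_space_eq)
  have K [measurable]: "K \<in> measurable \<Omega> (count_space UNIV)" using W by (simp add: biased_reflected_walk_def)
  have X [measurable]: "X i \<in> measurable \<Omega> (count_space UNIV)" for i
    using mc[of 0] measurable_cong_sets[OF sets[of 0] refl] by (auto simp: markov_chain_def)
  have A: "A \<in> sets \<Omega>" unfolding A_def by measurable
  have spm: "space (geometric_mixture \<alpha> P) = space \<Omega>"
    unfolding geometric_mixture_def by (rule space_bind) (use sets in auto)
  have k0: "emeasure (P k) A = ennreal (tail_prob \<beta> t k)" for k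
  proof (cases "k = 0")
    case True
    have "AE \<omega> in P 0. \<omega> \<notin> A" using ae[of 0] by (auto simp: A_def)
    then have "emeasure (P 0) A = 0" using A sets[of 0] by (subst (asm) AE_iff_measurable[of A]) (auto simp: A_def sp)
    then show ?thesis using True by (simp add: tail_prob_def)
  next
    case False
    have "emeasure (P k) A = emeasure (P k) {\<omega> \<in> space (P k). \<forall>i. 0 < i \<and> i \<le> Suc n \<longrightarrow> X i \<omega> \<noteq> 0}"
    proof (rule emeasure_eq_AE)
      show "AE x in P k. (x \<in> A) = (x \<in> {\<omega> \<in> space (P k). \<forall>i. 0 < i \<and> i \<le> Suc n \<longrightarrow> X i \<omega> \<noteq> 0})"
        using ae[of k] by (rule AE_mp) (use False in \<open>auto simp: A_def sp intro!: AE_I2\<close>)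
      show "A \<in> sets (P k)" using A sets by simp
      show "{\<omega> \<in> space (P k). \<forall>i. 0 < i \<and> i \<le> Suc n \<longrightarrow> X i \<omega> \<noteq> 0} \<in> sets (P k)"
        unfolding sp sets by measurable
    qed
    also have "\<dots> = ennreal (survival \<beta> k n 1)"
      by (rule prob_no_return[OF b _ mc]) (use False in simp)
    finally show ?thesis using False by (simp add: tail_prob_def n_def)
  qed
  have "summable (\<lambda>k. (1 - \<alpha>) * \<alpha> ^ k * tail_prob \<beta> t k)"
    by (rule summable_comparison_test'[where g = "\<lambda>k. (1 - \<alpha>) * \<alpha> ^ k"])
      (use a tail_prob_bounds[OF b] in \<open>auto simp: abs_mult intro!: summable_mult summable_geometric mult_left_le\<close>)
  then have "emeasure (geometric_mixture \<alpha> P) A = ennreal (\<Sum>k. (1 - \<alpha>) * \<alpha> ^ k * tail_prob \<beta> t k)"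
    unfolding emeasure_geometric_mixture[OF W a A] k0
    using a tail_prob_bounds[OF b] by (subst suminf_ennreal2[symmetric]) (auto simp: ennreal_mult)
  moreover have "{\<omega> \<in> space (geometric_mixture \<alpha> P). ereal_of_enat (excursion_length K X \<omega>) > ereal t} = A"
    using excursion_length_gt_iff[of t K X] t unfolding spm n A_def by auto
  moreover have "0 \<le> (\<Sum>k. (1 - \<alpha>) * \<alpha> ^ k * tail_prob \<beta> t k)"
    using a tail_prob_bounds[OF b] \<open>summable _\<close> by (intro suminf_nonneg) auto
  ultimately show ?thesis by (simp add: measure_def)
qed

text \<open>
  Passing from the \<open>n\<close> steps of the killed walk to the real time \<open>t\<close>, where \<open>t - 2 \<le> n \<le> t\<close>, changes the
  exponential by at most \<open>2 exit_rate\<close>, which is of smaller order than the error already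
  present. For \<open>k = 0\<close> the claim is trivial, since the right-hand side is at least the exponential.
\<close>

lemma tail_prob_error:
  assumes b: "\<beta> > 1"
  obtains C r where "C > 0" "0 < r" "r < 1" "\<And>k t. t \<ge> 1 \<Longrightarrow>
    \<bar>tail_prob \<beta> t k - (1 - 1 / \<beta>) * exp (- (exit_rate \<beta> k * t))\<bar>
      \<le> C * exp (- (exit_rate \<beta> k * t / 4)) * (r powr t + (1 / sqrt (sqrt \<beta>)) ^ k)"
proof -
  obtain C r where C: "C > 0" and r: "0 < r" "r < 1" and err: "\<And>k n. k \<ge> 1 \<Longrightarrow>
    \<bar>survival \<beta> k n 1 - (1 - 1 / \<beta>) * exp (- (exit_rate \<beta> k * real n))\<bar>
      \<le> C * exp (- (exit_rate \<beta> k * real n / 4)) * (r ^ n + (1 / sqrt (sqrt \<beta>)) ^ k)"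
    using survival_error[OF b] by metis
  define c where "c = (\<beta> - 1)\<^sup>2 / (2 * \<beta>)"
  define \<sigma> where "\<sigma> = 1 / sqrt (sqrt \<beta>)"
  have c: "c > 0" using b by (simp add: c_def)
  have s4: "\<sigma> > 0" "\<sigma> \<le> 1" using b by (auto simp: \<sigma>_def)
  \<comment> \<open>The first summand covers \<open>k \<ge> 1\<close>, and the final \<open>1\<close> covers \<open>k = 0\<close>.\<close>
  define D where "D = exp 1 * (C / r\<^sup>2 + (C + 2 * c)) + 1"
  have D: "D > 0" using C r c unfolding D_def by (intro add_pos_pos mult_pos_pos) auto
  show thesis
  proof (rule that[OF D r])
    fix k :: nat and t :: real assume t: "t \<ge> 1"
    define lam where "lam = exit_rate \<beta> k"
    have l0: "lam > 0" using exit_rate_pos[OF b] by (simp add: lam_def)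
    define E where "E = exp (- (lam * t / 4))"
    show "\<bar>tail_prob \<beta> t k - (1 - 1 / \<beta>) * exp (- (exit_rate \<beta> k * t))\<bar>
      \<le> D * exp (- (exit_rate \<beta> k * t / 4)) * (r powr t + (1 / sqrt (sqrt \<beta>)) ^ k)"
    proof (cases "k = 0")
      case True
      have "\<bar>tail_prob \<beta> t k - (1 - 1 / \<beta>) * exp (- (lam * t))\<bar> = (1 - 1 / \<beta>) * exp (- (lam * t))"
        using True b by (simp add: tail_prob_def)
      also have "\<dots> \<le> 1 * exp (- (lam * t / 4))"
        using b l0 t by (intro mult_mono) auto
      also have "\<dots> \<le> D * E * 1"
        using C r c unfolding D_def E_def by simp
      also have "\<dots> \<le> D * E * (r powr t + (1 / sqrt (sqrt \<beta>)) ^ k)"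
        using True D by (intro mult_left_mono) (auto simp: E_def)
      finally show ?thesis by (simp add: lam_def E_def)
    next
      case False
      define n where "n = nat \<lfloor>t\<rfloor> - 1"
      have n: "t - 2 \<le> real n" "real n \<le> t" using t unfolding n_def by linarith+
      have l1: "lam \<le> 1" using exit_rate_le_1[OF b, of k] False by (simp add: lam_def)
      have ls: "lam \<le> c * \<sigma> ^ k"
      proof -
        have "lam = c * (1 / \<beta>) ^ k" by (simp add: lam_def exit_rate_def c_def power_divide)
        also have "1 / \<beta> \<le> \<sigma>"
        proof -
          have "\<sigma>\<^sup>2 = 1 / sqrt \<beta>" using b by (simp add: \<sigma>_def power_divide)
          then have "(\<sigma>\<^sup>2)\<^sup>2 = 1 / \<beta>" using b by (simp only: power_divide) simp
          then have "1 / \<beta> = \<sigma> ^ 4" by simp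
          also have "\<dots> \<le> \<sigma>" using s4 power_decreasing[of 1 4 \<sigma>] by simp
          finally show ?thesis .
        qed
        then have "c * (1 / \<beta>) ^ k \<le> c * \<sigma> ^ k"
          using b c by (intro mult_left_mono power_mono) auto
        finally show ?thesis .
      qed
      have En: "exp (- (lam * real n / 4)) \<le> exp 1 * E"
      proof -
        have "lam * (t - 2) \<le> lam * real n" using n l0 by (intro mult_left_mono) auto
        then have "- (lam * real n / 4) \<le> 1 + - (lam * t / 4)" using l1 by (simp add: algebra_simps)
        then show ?thesis unfolding E_def exp_add[symmetric] by simp
      qed
      have rn: "r ^ n \<le> r powr t / r\<^sup>2"
      proof -
        have "r ^ n = r powr real n" using r by (simp add: powr_realpow)
        also have "\<dots> \<le> r powr (t - 2)" using n r by (intro powr_mono') auto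
        also have "\<dots> = r powr t / r\<^sup>2" using r by (simp add: powr_diff powr_numeral)
        finally show ?thesis .
      qed
      have shift: "\<bar>exp (- (lam * real n)) - exp (- (lam * t))\<bar> \<le> exp (- (lam * real n / 4)) * (2 * lam)"
      proof -
        have d: "0 \<le> lam * (t - real n)" "lam * (t - real n) \<le> 2 * lam"
          using n l0 mult_left_mono[of "t - real n" 2 lam] by auto
        have "exp (- (lam * real n)) - exp (- (lam * t)) = exp (- (lam * real n)) * (1 - exp (- (lam * (t - real n))))"
          by (simp add: right_diff_distrib exp_add[symmetric] algebra_simps)
        moreover have "0 \<le> 1 - exp (- (lam * (t - real n)))" using d by simp
        moreover have "1 - exp (- (lam * (t - real n))) \<le> 2 * lam"
          using exp_ge_add_one_self[of "- (lam * (t - real n))"] d by linarith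
        moreover have "exp (- (lam * real n)) \<le> exp (- (lam * real n / 4))" using l0 by simp
        ultimately show ?thesis by (simp add: mult_mono)
      qed
      have "\<bar>tail_prob \<beta> t k - (1 - 1 / \<beta>) * exp (- (lam * t))\<bar>
        \<le> \<bar>survival \<beta> k n 1 - (1 - 1 / \<beta>) * exp (- (lam * real n))\<bar>
          + \<bar>(1 - 1 / \<beta>) * (exp (- (lam * real n)) - exp (- (lam * t)))\<bar>"
        using False unfolding tail_prob_def n_def[symmetric] right_diff_distrib by simp
      also have "\<dots> \<le> C * exp (- (lam * real n / 4)) * (r ^ n + \<sigma> ^ k) + 1 * (exp (- (lam * real n / 4)) * (2 * lam))"
        unfolding abs_mult using err[of k n] shift False b
        by (intro add_mono mult_mono) (auto simp: lam_def \<sigma>_def)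
      also have "\<dots> = exp (- (lam * real n / 4)) * (C * (r ^ n + \<sigma> ^ k) + 2 * lam)"
        by (simp add: algebra_simps)
      also have "\<dots> \<le> (exp 1 * E) * (C * (r powr t / r\<^sup>2 + \<sigma> ^ k) + 2 * (c * \<sigma> ^ k))"
        using En rn ls C r s4 l0 by (intro mult_mono add_mono mult_left_mono) (auto simp: E_def)
      also have "\<dots> \<le> D * E * (r powr t + \<sigma> ^ k)"
      proof -
        have "D * E * (r powr t + \<sigma> ^ k) - (exp 1 * E) * (C * (r powr t / r\<^sup>2 + \<sigma> ^ k) + 2 * (c * \<sigma> ^ k))
           = E * (r powr t + \<sigma> ^ k) + exp 1 * E * ((C + 2 * c) * r powr t + C / r\<^sup>2 * \<sigma> ^ k)"
          by (simp add: D_def algebra_simps add_divide_distrib)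
        also have "\<dots> \<ge> 0" using C c r s4 unfolding E_def by (intro add_nonneg_nonneg mult_nonneg_nonneg) auto
        finally show ?thesis by linarith
      qed
      finally show ?thesis by (simp add: lam_def E_def \<sigma>_def)
    qed
  qed
qed

text \<open>
  The factor \<open>\<sigma> ^ k = \<beta> powr (- k / 4)\<close> in the error makes the weights \<open>\<alpha> ^ k\<close> decay faster. So
  \<open>exp (- exit_rate t / 4)\<close>, of order at most \<open>(\<beta> ^ k / t) powr \<tau>\<close> for every \<open>\<tau> \<ge> 0\<close>, can be used with an exponent
  \<open>\<tau>\<close> slightly larger than \<open>\<rho>\<close>, and the series still converges: its ratio \<open>\<theta>\<close> is \<open>\<beta> powr - (1 / 8)\<close>.
\<close>

lemma tail_sum_error:
  assumes b: "\<beta> > 1" and a: "0 < \<alpha>" "\<alpha> < 1"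
  obtains C where "\<And>t. t \<ge> 1 \<Longrightarrow>
    \<bar>(\<Sum>k. (1 - \<alpha>) * \<alpha> ^ k * tail_prob \<beta> t k)
       - (1 - \<alpha>) * (1 - 1 / \<beta>) * (\<Sum>k. \<alpha> ^ k * exp (- (exit_rate \<beta> k * t)))\<bar>
    \<le> C * t powr - (varrho \<alpha> \<beta> + 1 / 8)"
proof -
  define \<rho> where "\<rho> = varrho \<alpha> \<beta>"
  \<comment> \<open>Any exponent strictly between \<open>\<rho>\<close> and \<open>\<rho> + 1 / 4\<close> works.\<close>
  define \<tau> where "\<tau> = \<rho> + 1 / 8"
  define \<sigma> where "\<sigma> = 1 / sqrt (sqrt \<beta>)"
  define c where "c = (\<beta> - 1)\<^sup>2 / (2 * \<beta>)"
  define \<theta> where "\<theta> = \<alpha> * \<sigma> * \<beta> powr \<tau>"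
  obtain C r where C: "C > 0" and r: "0 < r" "r < 1" and err: "\<And>k t. t \<ge> 1 \<Longrightarrow>
    \<bar>tail_prob \<beta> t k - (1 - 1 / \<beta>) * exp (- (exit_rate \<beta> k * t))\<bar>
      \<le> C * exp (- (exit_rate \<beta> k * t / 4)) * (r powr t + \<sigma> ^ k)"
    unfolding \<sigma>_def using tail_prob_error[OF b] by metis
  have \<rho>: "\<rho> > 0" using a b by (simp add: \<rho>_def varrho_def divide_neg_pos)
  then have \<tau>: "\<tau> \<ge> 0" by (simp add: \<tau>_def)
  have c: "c > 0" using b by (simp add: c_def)
  have \<alpha>: "\<alpha> = \<beta> powr - \<rho>" using a b by (simp add: powr_def \<rho>_def varrho_def)
  have \<sigma>: "\<sigma> = \<beta> powr - (1 / 4)"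
  proof -
    have "sqrt (sqrt \<beta>) = (\<beta> powr (1 / 2)) powr (1 / 2)" using b by (simp add: powr_half_sqrt)
    also have "\<dots> = \<beta> powr (1 / 4)" by (simp only: powr_powr) simp
    finally show ?thesis unfolding \<sigma>_def powr_minus_divide by (simp only:)
  qed
  have \<theta>: "0 < \<theta>" "\<theta> < 1"
  proof -
    have "\<theta> = \<beta> powr - (1 / 8)"
      unfolding \<theta>_def \<alpha> \<sigma> powr_add[symmetric] by (simp add: \<tau>_def)
    then show "0 < \<theta>" "\<theta> < 1" using b by (auto simp: powr_minus_divide)
  qed
  define M1 where "M1 = exp (\<tau>\<^sup>2 / 2) * (- ln r) powr - \<tau>"
  define M2 where "M2 = exp (\<tau>\<^sup>2 / 2) * (c / 4) powr - \<tau>"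
  show thesis
  proof (rule that)
    fix t :: real assume t: "t \<ge> 1"
    define e where "e k = tail_prob \<beta> t k - (1 - 1 / \<beta>) * exp (- (exit_rate \<beta> k * t))" for k
    have rpos: "exit_rate \<beta> k * t \<ge> 0" for k using exit_rate_pos[OF b, of k] t by simp
    have S1: "summable (\<lambda>k. (1 - \<alpha>) * \<alpha> ^ k * tail_prob \<beta> t k)"
      by (rule summable_comparison_test'[where g = "\<lambda>k. (1 - \<alpha>) * \<alpha> ^ k"])
        (use a tail_prob_bounds[OF b] in \<open>auto simp: abs_mult intro!: summable_mult summable_geometric mult_left_le\<close>)
    have S2: "summable (\<lambda>k. \<alpha> ^ k * exp (- (exit_rate \<beta> k * t)))"
      by (rule summable_comparison_test'[where g = "\<lambda>k. \<alpha> ^ k"])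
        (use a rpos in \<open>auto simp: abs_mult intro!: summable_geometric mult_left_le\<close>)
    have bound: "norm ((1 - \<alpha>) * \<alpha> ^ k * e k) \<le> C * t powr - \<tau> * (M1 * \<alpha> ^ k + M2 * \<theta> ^ k)" for k
    proof -
      have r_le: "r powr t \<le> M1 * t powr - \<tau>"
        using exp_minus_le_powr[of "- ln r" t \<tau>] r t \<tau> by (simp add: powr_def[of r] M1_def mult.commute)
      have e_le: "exp (- (exit_rate \<beta> k * t / 4)) \<le> M2 * t powr - \<tau> * (\<beta> powr \<tau>) ^ k"
      proof -
        have rate: "exit_rate \<beta> k * t / 4 = c / 4 * (t / \<beta> ^ k)" by (simp add: exit_rate_def c_def)
        have "exp (- (exit_rate \<beta> k * t / 4)) \<le> M2 * (t / \<beta> ^ k) powr - \<tau>"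
          unfolding rate M2_def by (rule exp_minus_le_powr) (use c b t \<tau> in auto)
        also have "(t / \<beta> ^ k) powr - \<tau> = t powr - \<tau> * (\<beta> ^ k) powr \<tau>"
          using b t by (simp add: powr_divide powr_minus field_simps)
        also have "(\<beta> ^ k) powr \<tau> = (\<beta> powr \<tau>) ^ k"
          using b by (simp add: powr_realpow[symmetric] powr_powr mult.commute)
        finally show ?thesis by (simp add: mult.assoc)
      qed
      have E1: "exp (- (exit_rate \<beta> k * t / 4)) \<le> 1" using rpos[of k] by simp
      have s0: "0 \<le> \<sigma>" using \<sigma> by simp
      have "norm ((1 - \<alpha>) * \<alpha> ^ k * e k) = (1 - \<alpha>) * \<alpha> ^ k * \<bar>e k\<bar>" using a by (simp add: abs_mult)
      also have "\<dots> \<le> 1 * \<alpha> ^ k * (C * exp (- (exit_rate \<beta> k * t / 4)) * (r powr t + \<sigma> ^ k))"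
        unfolding e_def using a err[OF t, of k] by (intro mult_mono) auto
      also have "\<dots> = C * (\<alpha> ^ k * (exp (- (exit_rate \<beta> k * t / 4)) * r powr t)
           + \<alpha> ^ k * \<sigma> ^ k * exp (- (exit_rate \<beta> k * t / 4)))"
        by (simp add: algebra_simps)
      also have "\<dots> \<le> C * (\<alpha> ^ k * (1 * (M1 * t powr - \<tau>)) + \<alpha> ^ k * \<sigma> ^ k * (M2 * t powr - \<tau> * (\<beta> powr \<tau>) ^ k))"
        using C a s0 E1 r_le e_le by (intro mult_left_mono add_mono mult_mono) auto
      also have "\<dots> = C * t powr - \<tau> * (M1 * \<alpha> ^ k + M2 * \<theta> ^ k)"
        by (simp add: \<theta>_def power_mult_distrib algebra_simps)
      finally show ?thesis .
    qed
    have maj: "(\<lambda>k. C * t powr - \<tau> * (M1 * \<alpha> ^ k + M2 * \<theta> ^ k)) sums (C * t powr - \<tau> * (M1 * (1 / (1 - \<alpha>)) + M2 * (1 / (1 - \<theta>))))"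
      using a \<theta> by (intro sums_mult sums_add geometric_sums) auto
    have "(\<Sum>k. (1 - \<alpha>) * \<alpha> ^ k * tail_prob \<beta> t k)
        - (1 - \<alpha>) * (1 - 1 / \<beta>) * (\<Sum>k. \<alpha> ^ k * exp (- (exit_rate \<beta> k * t)))
      = (\<Sum>k. (1 - \<alpha>) * \<alpha> ^ k * tail_prob \<beta> t k - (1 - \<alpha>) * (1 - 1 / \<beta>) * (\<alpha> ^ k * exp (- (exit_rate \<beta> k * t))))"
      by (subst suminf_mult[OF S2, symmetric]) (rule suminf_diff[OF S1 summable_mult[OF S2]])
    also have "\<dots> = (\<Sum>k. (1 - \<alpha>) * \<alpha> ^ k * e k)"
    proof -
      have "x * y * z - x * v * (y * w) = x * y * (z - v * w)" for x y z v w :: real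
        by (simp only: right_diff_distrib mult_ac)
      then show ?thesis unfolding e_def by (simp only:)
    qed
    also have "\<bar>\<dots>\<bar> \<le> C * t powr - \<tau> * (M1 * (1 / (1 - \<alpha>)) + M2 * (1 / (1 - \<theta>)))"
      using norm_suminf_le[OF bound sums_summable[OF maj]] sums_unique[OF maj] by simp
    finally show "\<bar>(\<Sum>k. (1 - \<alpha>) * \<alpha> ^ k * tail_prob \<beta> t k)
       - (1 - \<alpha>) * (1 - 1 / \<beta>) * (\<Sum>k. \<alpha> ^ k * exp (- (exit_rate \<beta> k * t)))\<bar>
      \<le> C * (M1 * (1 / (1 - \<alpha>)) + M2 * (1 / (1 - \<theta>))) * t powr - (varrho \<alpha> \<beta> + 1 / 8)"
      by (simp add: \<tau>_def \<rho>_def mult_ac)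
  qed
qed

theorem theorem1p1:
  fixes \<alpha> \<beta> :: real
    and \<Omega> :: "'w measure" and P :: "nat \<Rightarrow> 'w measure"
    and K :: "'w \<Rightarrow> nat" and X :: "nat \<Rightarrow> 'w \<Rightarrow> nat"
  assumes "\<beta> > 1" and "0 < \<alpha>" and "\<alpha> < 1"
    and "biased_reflected_walk \<beta> \<Omega> P K X"
  shows "((\<lambda>t::real.
            t powr varrho \<alpha> \<beta>
              * \<P>(\<omega> in geometric_mixture \<alpha> P. ereal_of_enat (excursion_length K X \<omega>) > ereal t)
              / g_fun \<alpha> \<beta> ((\<beta> - 1)\<^sup>2 / (2 * \<beta>) * t))
          \<longlongrightarrow> 1) at_top"
proof -
  note b = assms(1) and a = assms(2,3)
  define \<rho> where "\<rho> = varrho \<alpha> \<beta>"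
  define L where "L = ln \<beta>"
  define c where "c = (\<beta> - 1)\<^sup>2 / (2 * \<beta>)"
  define q where "q = (1 - 1 / \<beta>) * (1 - \<alpha>) * c powr - \<rho>"
  define p where "p t = \<P>(\<omega> in geometric_mixture \<alpha> P. ereal_of_enat (excursion_length K X \<omega>) > ereal t)" for t
  define g where "g t = g_fun \<alpha> \<beta> (c * t)" for t
  have L: "L > 0" using b by (simp add: L_def)
  have \<rho>: "\<rho> > 0" using a b by (simp add: \<rho>_def varrho_def divide_neg_pos)
  have c: "c > 0" using b by (simp add: c_def)
  have q: "q > 0" using a b c by (simp add: q_def)
  have \<alpha>: "exp (- \<rho> * L) = \<alpha>" using a b by (simp add: \<rho>_def L_def varrho_def)
  have g_eq: "g t = q * periodized_kernel \<rho> L (ln (c * t)) 0" for t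
  proof -
    have "(2 * \<beta> / (\<beta> - 1)\<^sup>2) powr \<rho> = c powr - \<rho>"
      using b by (simp add: c_def powr_minus powr_divide)
    moreover have "(\<beta> - 1) / \<beta> = 1 - 1 / \<beta>" using b by (simp add: field_simps)
    ultimately show ?thesis
      unfolding g_def q_def \<rho>_def L_def
      by (subst g_fun_eq_periodized_kernel) (use L \<rho> in \<open>simp_all add: L_def \<rho>_def\<close>)
  qed
  \<comment> \<open>The exponents match because \<open>\<alpha> = exp (- \<rho> L)\<close> and \<open>c t / \<beta> ^ k = exit_rate \<beta> k * t\<close>.\<close>
  have kernel: "gamma_kernel \<rho> (ln (c * t) - L * real k) = (c * t) powr \<rho> * (\<alpha> ^ k * exp (- (exit_rate \<beta> k * t)))"
    if t: "t > 0" for t k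
  proof -
    have "exp (\<rho> * (ln (c * t) - L * real k)) = (c * t) powr \<rho> * \<alpha> ^ k"
      using c t unfolding \<alpha>[symmetric] exp_of_nat_mult[symmetric]
      by (simp add: powr_def exp_add[symmetric] algebra_simps)
    moreover have "exp (ln (c * t) - L * real k) = exit_rate \<beta> k * t"
    proof -
      have "exp (L * real k) = \<beta> ^ k"
        using b exp_of_nat_mult[of k L] by (simp add: L_def mult.commute)
      moreover have "exp (ln (c * t)) = c * t" using c t by simp
      ultimately show ?thesis unfolding exp_diff by (simp add: exit_rate_def c_def)
    qed
    ultimately show ?thesis by (simp add: gamma_kernel_def exp_diff exp_minus divide_inverse mult.assoc)
  qed
  obtain C where C: "\<And>t. t \<ge> 1 \<Longrightarrow>
    \<bar>(\<Sum>k. (1 - \<alpha>) * \<alpha> ^ k * tail_prob \<beta> t k)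
       - (1 - \<alpha>) * (1 - 1 / \<beta>) * (\<Sum>k. \<alpha> ^ k * exp (- (exit_rate \<beta> k * t)))\<bar>
    \<le> C * t powr - (\<rho> + 1 / 8)"
    by (rule tail_sum_error[OF b a, folded \<rho>_def]) (rule that)
  define C' where "C' = q * (exp (2 * \<rho>\<^sup>2) / (1 - exp (- \<rho> * L)))"
  define g0 where "g0 = q * exp (- exp L)"
  have g0: "g0 > 0" using q by (simp add: g0_def)
  have main: "\<bar>t powr \<rho> * p t / g t - 1\<bar> \<le> (C * t powr - (1 / 8) + C' * (c * t) powr - \<rho>) / g0"
    if t: "t \<ge> 1" and ct: "c * t \<ge> 1" for t
  proof -
    have u: "ln (c * t) \<ge> 0" using ct by simp
    have g_ge: "g0 \<le> g t"
      unfolding g0_def g_eq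
      by (rule mult_left_mono[OF periodized_kernel_lower_bound[OF \<rho> L u] less_imp_le[OF q]])
    define S where "S = (\<Sum>k. \<alpha> ^ k * exp (- (exit_rate \<beta> k * t)))"
    have "(\<Sum>k. gamma_kernel \<rho> (ln (c * t) - L * real k)) = (\<Sum>k. (c * t) powr \<rho> * (\<alpha> ^ k * exp (- (exit_rate \<beta> k * t))))"
      using t by (intro arg_cong[where f = suminf] ext kernel) simp
    also have "\<dots> = (c * t) powr \<rho> * S"
    proof -
      have rate: "exit_rate \<beta> k * t \<ge> 0" for k using exit_rate_pos[OF b, of k] t by simp
      have "summable (\<lambda>k. \<alpha> ^ k * exp (- (exit_rate \<beta> k * t)))"
        by (rule summable_comparison_test'[where g = "\<lambda>k. \<alpha> ^ k"])
          (use a rate in \<open>auto simp: abs_mult intro!: summable_geometric mult_left_le\<close>)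
      then show ?thesis unfolding S_def by (rule suminf_mult)
    qed
    finally have S: "(\<Sum>k. gamma_kernel \<rho> (ln (c * t) - L * real k)) = (c * t) powr \<rho> * S" .
    \<comment> \<open>The constant \<open>q\<close> is chosen such that the main term is \<open>q\<close> times the one-sided kernel sum.\<close>
    have scale: "q * (c * t) powr \<rho> = t powr \<rho> * ((1 - \<alpha>) * (1 - 1 / \<beta>))"
      using c t by (simp add: q_def powr_mult powr_minus)
    have "t powr \<rho> * p t - g t
        = t powr \<rho> * (p t - (1 - \<alpha>) * (1 - 1 / \<beta>) * S)
          + q * ((c * t) powr \<rho> * S - periodized_kernel \<rho> L (ln (c * t)) 0)"
      unfolding g_eq right_diff_distrib mult.assoc[symmetric] scale by (simp add: algebra_simps)
    also have "\<bar>\<dots>\<bar> \<le> t powr \<rho> * (C * t powr - (\<rho> + 1 / 8))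
        + q * (exp (2 * \<rho>\<^sup>2) / (1 - exp (- \<rho> * L)) * exp (- (\<rho> * ln (c * t))))"
    proof (rule order_trans[OF abs_triangle_ineq add_mono])
      have "\<bar>p t - (1 - \<alpha>) * (1 - 1 / \<beta>) * S\<bar> \<le> C * t powr - (\<rho> + 1 / 8)"
        unfolding p_def prob_excursion_gt[OF b a assms(4) t] S_def by (rule C[OF t])
      then show "\<bar>t powr \<rho> * (p t - (1 - \<alpha>) * (1 - 1 / \<beta>) * S)\<bar> \<le> t powr \<rho> * (C * t powr - (\<rho> + 1 / 8))"
        unfolding abs_mult by (intro mult_mono) auto
      show "\<bar>q * ((c * t) powr \<rho> * S - periodized_kernel \<rho> L (ln (c * t)) 0)\<bar>
          \<le> q * (exp (2 * \<rho>\<^sup>2) / (1 - exp (- \<rho> * L)) * exp (- (\<rho> * ln (c * t))))"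
        unfolding abs_mult abs_of_pos[OF q]
        using one_sided_kernel_sum[OF \<rho> L u] q unfolding S by (intro mult_left_mono) auto
    qed
    also have "\<dots> = C * t powr - (1 / 8) + C' * (c * t) powr - \<rho>"
    proof -
      have "t powr \<rho> * t powr - (\<rho> + 1 / 8) = t powr (\<rho> + - (\<rho> + 1 / 8))"
        by (rule powr_add[symmetric])
      then have "t powr \<rho> * (C * t powr - (\<rho> + 1 / 8)) = C * t powr - (1 / 8)" by simp
      moreover have "exp (- (\<rho> * ln (c * t))) = (c * t) powr - \<rho>" using c t by (simp add: powr_def)
      ultimately show ?thesis unfolding C'_def by (simp only: mult.assoc)
    qed
    finally have diff: "\<bar>t powr \<rho> * p t - g t\<bar> \<le> C * t powr - (1 / 8) + C' * (c * t) powr - \<rho>" .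
    have g_pos: "g t > 0" using g_ge g0 by linarith
    then have "t powr \<rho> * p t / g t - 1 = (t powr \<rho> * p t - g t) / g t"
      by (simp add: diff_divide_distrib)
    then have "\<bar>t powr \<rho> * p t / g t - 1\<bar> = \<bar>t powr \<rho> * p t - g t\<bar> / g t"
      using g_pos by (simp only: abs_divide abs_of_pos)
    also have "\<dots> \<le> (C * t powr - (1 / 8) + C' * (c * t) powr - \<rho>) / g0"
      using diff g_ge g0 by (intro frac_le) auto
    finally show ?thesis .
  qed
  have lim: "((\<lambda>t. (C * t powr - (1 / 8) + C' * (c * t) powr - \<rho>) / g0) \<longlongrightarrow> (C * 0 + C' * 0) / g0) at_top"
  proof (intro tendsto_intros)
    show "((\<lambda>t::real. t powr - (1 / 8)) \<longlongrightarrow> 0) at_top"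
      by (rule tendsto_neg_powr) (auto simp: filterlim_ident)
    show "((\<lambda>t. (c * t) powr - \<rho>) \<longlongrightarrow> 0) at_top"
      by (rule tendsto_neg_powr) (use c \<rho> in \<open>auto intro!: filterlim_tendsto_pos_mult_at_top[OF tendsto_const] filterlim_ident\<close>)
  qed (use g0 in simp)
  have "((\<lambda>t. t powr \<rho> * p t / g t - 1) \<longlongrightarrow> 0) at_top"
  proof (rule Lim_null_comparison)
    have "\<forall>\<^sub>F t in at_top. 1 \<le> t \<and> 1 / c \<le> t"
      by (intro eventually_conj eventually_ge_at_top)
    then show "\<forall>\<^sub>F t in at_top. norm (t powr \<rho> * p t / g t - 1)
        \<le> (C * t powr - (1 / 8) + C' * (c * t) powr - \<rho>) / g0"
    proof eventually_elim
      case (elim t)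
      have "c * t \<ge> 1" using elim c by (simp add: divide_le_eq mult.commute)
      then show ?case using main[of t] elim by simp
    qed
  qed (use lim in simp)
  then have "((\<lambda>t. t powr \<rho> * p t / g t) \<longlongrightarrow> 1) at_top"
    by (simp only: LIM_zero_iff)
  then show ?thesis by (simp only: p_def g_def \<rho>_def c_def)
qed

end
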